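(* Let $D=(a,b,\alpha,\beta,\gamma,\beta')$ be an admissible parameter tuple such that $|\psi_D\rangle$ is truly tripartite entangled. Then the values of the five measures $E_1,\dots,E_5$ characterize the set $\mathcal{S}_D$ uniquely up to local unitaries: a three-qubit state $|\chi\rangle$ is LU-equivalent to $|\psi_{\hat D}\rangle$ for some admissible parameter tuple $\hat D$ with $E_i(\hat D)=E_i(D)$ for all $i=1,\dots,5$ if and only if $|\chi\rangle$ is LU-equivalent to one of the (at most four) states in $\mathcal{S}_D$.
   Context: A pure three-qubit state is truly tripartite entangled if it is not a product state with respect to any of the bipartitions $1|23$, $2|13$, $3|12$. Two three-qubit states are LU-equivalent if they are related by $V_1\otimes V_2\otimes V_3$ with $V_i\in U(2)$. $\sigma_0=\mathbb{1}$, $\sigma_1,\sigma_2,\sigma_3$ are the Pauli matrices $\sigma_x,\sigma_y,\sigma_z$; $Y(\xi)=e^{i\xi\sigma_y}$, $Z(\xi)=e^{i\xi\sigma_z}$; $|+\rangle=(|0\rangle+|1\rangle)/\sqrt2$; $|\phi^+\rangle=(|00\rangle+|11\rangle)/\sqrt2$. An admissible parameter tuple is $D=(a,b,\alpha,\beta,\gamma,\beta')$ with $a\ge b\ge0$, $a^2+b^2=1$, $\alpha,\gamma\in(-\pi/2,\pi/2]$, $\beta,\beta'\in[0,\pi/2]$, where in the case $a=b$ one requires by convention $\gamma=0$ and $\beta'=0$. Put $|\psi_s\rangle=a|00\rangle+b|11\rangle$, $U_2=Z(\alpha)Y(\beta)Z(\gamma)$, $U_3=Y(\beta')$, and for $i=2,3$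 let $U_c^{1i}=|0\rangle\langle0|_1\otimes\mathbb{1}_i+|1\rangle\langle1|_1\otimes (U_i)_i$ (controlled unitary with control qubit $1$ and target $i$). Define $$|\psi_D\rangle=U_c^{13}U_c^{12}|+\rangle_1|\psi_s\rangle_{23}=\tfrac1{\sqrt2}\big(|0\rangle|\psi_s\rangle+|1\rangle (U_2\otimes U_3)|\psi_s\rangle\big),$$ $$\mathcal{S}_D=\{U_c^{13}U_c^{12}\,\sigma_n^{(2)}|+\rangle_1|\psi_s\rangle_{23}: n=0,1,2,3\},$$ where $\sigma_n^{(2)}$ acts on qubit $2$. The measures are the following; here entanglement of a bipartite pure state is the von Neumann entropy (base-2 logarithm) of either reduced state: - $E_1=E(\psi_s)$, the entanglement of $|\psi_s\rangle$; - $E_2=S\big(\tfrac12(|\phi^+\rangle\langle\phi^+|+(U_2\otimes\mathbb{1})|\phi^+\rangle\langle\phi^+|(U_2\otimes\mathbb{1})^\dagger)\big)$, with $S$ the von Neumann entropy (the entanglement of the Choi–Jamiolkowski state of $U_c^{12}$ in the splitting $1|2$); - $E_3$, defined as $E_2$ with $U_3$ in place of $U_2$; - $E_4$, the entanglement in the splitting $1|23$ of $U_c^{12}|+\rangle_1|\psi_s\rangle_{23}=\tfrac1{\sqrt2}(|0\rangle|\psi_s\rangle+|1\rangle(U_2\otimes\mathbb{1})|\psi_s\rangle)$; - $E_5$, the entanglement in the splitting $1|23$ of $a|+\rangle_1|00\rangle_{23}+b\,(U_2|+\rangle)_1|11\rangle_{23}$ (the same gate applied to $|+\rangle_1|\psi_s\rangle_{23}$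 with qubit $2$ as control and qubit $1$ as target). *)

theory Defs
  imports "HOL-Analysis.Analysis" "HOL-Computational_Algebra.Polynomial"
begin

text \<open>
  A vector of \<open>\<complex>\<^sup>I \<otimes> \<complex>\<^sup>J\<close> is a vector indexed by the product type of \<open>I\<close> and \<open>J\<close>; three qubits
  are indexed by \<open>2 \<times> (2 \<times> 2)\<close>, so that the splitting \<open>1|23\<close> is the outermost product.
\<close>

type_synonym qubit = "complex ^ 2"
type_synonym qubit2 = "complex ^ (2 \<times> 2)"
type_synonym qubit3 = "complex ^ (2 \<times> 2 \<times> 2)"

definition tensor_vec ::
    "complex ^ 'm::finite \<Rightarrow> complex ^ 'n::finite \<Rightarrow> complex ^ ('m \<times> 'n)" (infixr "\<otimes>\<^sub>v" 75)
  where "u \<otimes>\<^sub>v v = (\<chi> p. u $ fst p * v $ snd p)"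

definition tensor_mat ::
    "complex ^ 'm::finite ^ 'm \<Rightarrow> complex ^ 'n::finite ^ 'n \<Rightarrow>
     complex ^ ('m \<times> 'n) ^ ('m \<times> 'n)" (infixr "\<otimes>\<^sub>m" 75)
  where "A \<otimes>\<^sub>m B = (\<chi> p q. A $ fst p $ fst q * B $ snd p $ snd q)"

definition adjoint_mat :: "complex ^ 'n ^ 'n \<Rightarrow> complex ^ 'n ^ 'n"
  where "adjoint_mat A = (\<chi> i j. cnj (A $ j $ i))"

definition unitary_mat :: "complex ^ 'n ^ 'n \<Rightarrow> bool"
  where "unitary_mat U \<longleftrightarrow> adjoint_mat U ** U = mat 1 \<and> U ** adjoint_mat U = mat 1"

definition ketbra :: "complex ^ 'n \<Rightarrow> complex ^ 'n \<Rightarrow> complex ^ 'n ^ 'n"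
  where "ketbra u v = (\<chi> i j. u $ i * cnj (v $ j))"

text \<open>
  The class-based \<open>exp\<close> is not available for matrices, whose type carries the componentwise product.
\<close>

definition exp_mat :: "complex ^ 'n ^ 'n \<Rightarrow> complex ^ 'n ^ 'n"
  where "exp_mat A = (\<Sum>k. (1 / fact k :: real) *\<^sub>R (((**) A ^^ k) (mat 1)))"

definition char_poly_mat :: "complex ^ 'n ^ 'n \<Rightarrow> complex poly"
  where "char_poly_mat A = det (\<chi> i j. (if i = j then [:0, 1:] else 0) - [:A $ i $ j:])"

text \<open>
  The sum runs over the eigenvalues with algebraic multiplicity; \<open>Re\<close> only converts the type, as the
  eigenvalues of a density matrix are real. The convention \<open>0 log 0 = 0\<close> holds automatically.
\<close>

definition vn_entropy :: "complex ^ 'n ^ 'n \<Rightarrow> real"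
  where "vn_entropy \<rho> = - (\<Sum>x\<in>#proots (char_poly_mat \<rho>). Re x * log 2 (Re x))"

text \<open>
  Partial trace of \<open>|\<psi>\<rangle>\<langle>\<psi>|\<close> over the second party. The reduced state of the other party has the same
  nonzero spectrum, so the choice does not affect the entropy.
\<close>

definition reduced_state :: "complex ^ ('m::finite \<times> 'n::finite) \<Rightarrow> complex ^ 'm ^ 'm"
  where "reduced_state \<psi> = (\<chi> i j. \<Sum>k\<in>UNIV. ketbra \<psi> \<psi> $ (i, k) $ (j, k))"

definition entanglement :: "complex ^ ('m::finite \<times> 'n::finite) \<Rightarrow> real"
  where "entanglement \<psi> = vn_entropy (reduced_state \<psi>)"

definition truly_tripartite_entangled :: "qubit3 \<Rightarrow> bool"
  where "truly_tripartite_entangled \<psi> \<longleftrightarrow>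
    \<not> (\<exists>(u :: qubit) (v :: qubit2). \<forall>i j k. \<psi> $ (i, j, k) = u $ i * v $ (j, k)) \<and>
    \<not> (\<exists>(u :: qubit) (v :: qubit2). \<forall>i j k. \<psi> $ (i, j, k) = u $ j * v $ (i, k)) \<and>
    \<not> (\<exists>(u :: qubit) (v :: qubit2). \<forall>i j k. \<psi> $ (i, j, k) = u $ k * v $ (i, j))"

definition LU_equivalent :: "qubit3 \<Rightarrow> qubit3 \<Rightarrow> bool"
  where "LU_equivalent \<phi> \<psi> \<longleftrightarrow>
    (\<exists>V1 V2 V3. unitary_mat V1 \<and> unitary_mat V2 \<and> unitary_mat V3 \<and>
       \<phi> = (V1 \<otimes>\<^sub>m V2 \<otimes>\<^sub>m V3) *v \<psi>)"

text \<open>The list order of \<open>vector\<close> is the order of the computational basis \<open>|0\<rangle>, |1\<rangle>\<close>.\<close>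

definition ket0 :: qubit where "ket0 = vector [1, 0]"
definition ket1 :: qubit where "ket1 = vector [0, 1]"

definition ket_plus :: qubit
  where "ket_plus = (1 / sqrt 2) *\<^sub>R (ket0 + ket1)"

definition phi_plus :: qubit2
  where "phi_plus = (1 / sqrt 2) *\<^sub>R (ket0 \<otimes>\<^sub>v ket0 + ket1 \<otimes>\<^sub>v ket1)"

definition sigma_x :: "complex ^ 2 ^ 2" where "sigma_x = vector [vector [0, 1], vector [1, 0]]"
definition sigma_y :: "complex ^ 2 ^ 2" where "sigma_y = vector [vector [0, - \<i>], vector [\<i>, 0]]"
definition sigma_z :: "complex ^ 2 ^ 2" where "sigma_z = vector [vector [1, 0], vector [0, - 1]]"

definition pauli :: "nat \<Rightarrow> complex ^ 2 ^ 2"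
  where "pauli n = [mat 1, sigma_x, sigma_y, sigma_z] ! n"

definition rot_Y :: "real \<Rightarrow> complex ^ 2 ^ 2"
  where "rot_Y \<xi> = exp_mat (mat (\<i> * of_real \<xi>) ** sigma_y)"

definition rot_Z :: "real \<Rightarrow> complex ^ 2 ^ 2"
  where "rot_Z \<xi> = exp_mat (mat (\<i> * of_real \<xi>) ** sigma_z)"

definition ctrl12 :: "complex ^ 2 ^ 2 \<Rightarrow> complex ^ (2 \<times> 2 \<times> 2) ^ (2 \<times> 2 \<times> 2)"
  where "ctrl12 U = ketbra ket0 ket0 \<otimes>\<^sub>m mat 1 \<otimes>\<^sub>m mat 1 + ketbra ket1 ket1 \<otimes>\<^sub>m U \<otimes>\<^sub>m mat 1"

definition ctrl13 :: "complex ^ 2 ^ 2 \<Rightarrow> complex ^ (2 \<times> 2 \<times> 2) ^ (2 \<times> 2 \<times> 2)"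
  where "ctrl13 U = ketbra ket0 ket0 \<otimes>\<^sub>m mat 1 \<otimes>\<^sub>m mat 1 + ketbra ket1 ket1 \<otimes>\<^sub>m mat 1 \<otimes>\<^sub>m U"

record params =
  par_a :: real
  par_b :: real
  par_alpha :: real
  par_beta :: real
  par_gamma :: real
  par_beta' :: real

definition admissible :: "params \<Rightarrow> bool"
  where "admissible D \<longleftrightarrow>
    par_a D \<ge> par_b D \<and> par_b D \<ge> 0 \<and> (par_a D)\<^sup>2 + (par_b D)\<^sup>2 = 1 \<and>
    par_alpha D \<in> {- pi / 2 <.. pi / 2} \<and> par_gamma D \<in> {- pi / 2 <.. pi / 2} \<and>
    par_beta D \<in> {0 .. pi / 2} \<and> par_beta' D \<in> {0 .. pi / 2} \<and>
    (par_a D = par_b D \<longrightarrow> par_gamma D = 0 \<and> par_beta' D = 0)"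

definition psi_s :: "params \<Rightarrow> qubit2"
  where "psi_s D = par_a D *\<^sub>R (ket0 \<otimes>\<^sub>v ket0) + par_b D *\<^sub>R (ket1 \<otimes>\<^sub>v ket1)"

definition U2 :: "params \<Rightarrow> complex ^ 2 ^ 2"
  where "U2 D = rot_Z (par_alpha D) ** rot_Y (par_beta D) ** rot_Z (par_gamma D)"

definition U3 :: "params \<Rightarrow> complex ^ 2 ^ 2"
  where "U3 D = rot_Y (par_beta' D)"

definition psi_D :: "params \<Rightarrow> qubit3"
  where "psi_D D = (ctrl13 (U3 D) ** ctrl12 (U2 D)) *v (ket_plus \<otimes>\<^sub>v psi_s D)"

definition S_D :: "params \<Rightarrow> qubit3 set"
  where "S_D D = (\<lambda>n. (ctrl13 (U3 D) ** ctrl12 (U2 D) ** (mat 1 \<otimes>\<^sub>m pauli n \<otimes>\<^sub>m mat 1))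
                        *v (ket_plus \<otimes>\<^sub>v psi_s D)) ` {0..3}"

definition E1 :: "params \<Rightarrow> real"
  where "E1 D = entanglement (psi_s D)"

definition gate_entropy :: "complex ^ 2 ^ 2 \<Rightarrow> real"
  where "gate_entropy U = vn_entropy ((1 / 2 :: real) *\<^sub>R
    (ketbra phi_plus phi_plus +
     (U \<otimes>\<^sub>m mat 1) ** ketbra phi_plus phi_plus ** adjoint_mat (U \<otimes>\<^sub>m mat 1)))"

definition E2 :: "params \<Rightarrow> real"
  where "E2 D = gate_entropy (U2 D)"

definition E3 :: "params \<Rightarrow> real"
  where "E3 D = gate_entropy (U3 D)"

definition E4 :: "params \<Rightarrow> real"
  where "E4 D = entanglement (ctrl12 (U2 D) *v (ket_plus \<otimes>\<^sub>v psi_s D))"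

definition E5 :: "params \<Rightarrow> real"
  where "E5 D = entanglement
    (par_a D *\<^sub>R (ket_plus \<otimes>\<^sub>v ket0 \<otimes>\<^sub>v ket0)
     + par_b D *\<^sub>R ((U2 D *v ket_plus) \<otimes>\<^sub>v ket1 \<otimes>\<^sub>v ket1))"

end

theory Submission
  imports Defs
begin

text \<open>
  Write \<open>U\<^sub>2 = [[p, q], [- q\<^sup>*, p\<^sup>*]]\<close>. Each measure is \<open>h(s)\<close> for a strictly decreasing \<open>h\<close> on \<open>[0, 1]\<close>,
  where \<open>s\<close> is \<open>a\<^sup>2 - b\<^sup>2\<close> for \<open>E\<^sub>1\<close>, \<open>|Re p|\<close> for \<open>E\<^sub>2\<close>, \<open>cos \<beta>'\<close> for \<open>E\<^sub>3\<close>,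
  \<open>s\<^sup>2 = (Re p)\<^sup>2 + (a\<^sup>2 - b\<^sup>2)\<^sup>2 (Im p)\<^sup>2\<close> for \<open>E\<^sub>4\<close> and
  \<open>s\<^sup>2 = 1 - 4 a\<^sup>2 b\<^sup>2 (1 - (Re p)\<^sup>2 - (Im q)\<^sup>2)\<close> for \<open>E\<^sub>5\<close>.
  So if \<open>a > b > 0\<close>, the measures fix \<open>a\<close>, \<open>b\<close>, \<open>\<beta>'\<close> and the absolute values of the real and
  imaginary parts of \<open>p\<close> and \<open>q\<close>. Of the remaining sixteen sign patterns, local unitaries identify \<open>(p, q)\<close> with
  \<open>(- p, - q)\<close> and \<open>(p\<^sup>*, q)\<close>, and the Pauli operators lead to \<open>(p\<^sup>*, - q\<^sup>*)\<close>, \<open>(p\<^sup>*, q\<^sup>*)\<close> and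
  \<open>(p, - q)\<close>, which exhausts them. For \<open>b = 0\<close> only \<open>|p|\<close> and \<open>|q|\<close> matter, and for \<open>a = b\<close>
  only the conjugacy class of \<open>U\<^sub>2\<close> up to sign, that is \<open>|Re p|\<close>.
\<close>

subsection \<open>Entropies of one- and two-qubit states\<close>

lemma UNIV_2x2: "(UNIV :: (2 \<times> 2) set) = {(1,1), (1,2), (2,1), (2,2)}"
  using exhaust_2 by auto

lemma sum_prod_UNIV: "sum f (UNIV :: ('m::finite \<times> 'n::finite) set) = (\<Sum>i\<in>UNIV. \<Sum>j\<in>UNIV. f (i, j))"
  by (simp add: sum.cartesian_product)

text \<open>Laplace expansion along the first row for the product index type;
  \<open>m i j k x y z\<close> is the minor of rows \<open>i\<close>, \<open>j\<close>,
  \<open>k\<close> and columns \<open>x\<close>, \<open>y\<close>, \<open>z\<close>. The permutation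
  sum is unfolded by peeling off one index at a time.\<close>

lemma det_2x2:
  fixes A :: "'a::comm_ring_1 ^ (2 \<times> 2) ^ (2 \<times> 2)"
  defines "e \<equiv> \<lambda>i j. A $ i $ j"
  shows "det A =
    (let p = (1,1); q = (1,2); r = (2,1); s = (2,2);
         m = (\<lambda>i j k x y z. e i x * (e j y * e k z - e j z * e k y)
                            - e i y * (e j x * e k z - e j z * e k x)
                            + e i z * (e j x * e k y - e j y * e k x))
     in e p p * m q r s q r s - e p q * m q r s p r s + e p r * m q r s p q s - e p s * m q r s p q r)"
proof -
  have f1: "finite {(1,2), (2,1), (2,2::2)::2\<times>2}" "(1,1) \<notin> {(1,2), (2,1), (2,2::2)::2\<times>2}" by auto
  have f2: "finite {(2,1), (2,2::2)::2\<times>2}" "(1,2) \<notin> {(2,1), (2,2::2)::2\<times>2}" by auto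
  have f3: "finite {(2,2::2)::2\<times>2}" "(2,1) \<notin> {(2,2::2)::2\<times>2}" by auto
  show ?thesis
    unfolding det_def UNIV_2x2
    unfolding sum_over_permutations_insert[OF f1]
    unfolding sum_over_permutations_insert[OF f2]
    unfolding sum_over_permutations_insert[OF f3]
    unfolding permutes_sing e_def Let_def
    by (simp add: sign_swap_id permutation_swap_id permutation_compose sign_compose sign_id swap_id_eq) (simp add: algebra_simps)
qed

text \<open>The binary entropy, parametrized by the difference \<open>s\<close> of the two
  probabilities (1 + s)/2 and (1 - s)/2.\<close>

definition bin_ent :: "real \<Rightarrow> real"
  where "bin_ent s = - ((1 + s) / 2 * log 2 ((1 + s) / 2) + (1 - s) / 2 * log 2 ((1 - s) / 2))"

text \<open>The derivative at x in (0, 1) is half of log((1 - x)/(1 + x)), hence negative. The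
  endpoint t = 1, where the logarithm is singular, is settled by positivity of the entropy for s <
  1.\<close>

lemma bin_ent_less:
  assumes "0 \<le> s" "s < t" "t \<le> 1"
  shows "bin_ent t < bin_ent s"
proof (cases "t = 1")
  case True
  have "(1 + s) / 2 * log 2 ((1 + s) / 2) < 0" "(1 - s) / 2 * log 2 ((1 - s) / 2) < 0"
    using assms by (auto intro!: mult_pos_neg)
  then show ?thesis using True by (simp add: bin_ent_def)
next
  case False
  show ?thesis
  proof (rule DERIV_neg_imp_decreasing_open[OF \<open>s < t\<close>])
    fix x assume "s < x" "x < t"
    then have x: "0 < x" "x < 1" using assms by auto
    have g: "((\<lambda>y. y * log 2 y) has_real_derivative log 2 y + 1 / ln 2) (at y)" if "0 < y" for y :: real
      unfolding log_def using that by (auto intro!: derivative_eq_intros simp: field_simps)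
    have 1: "((\<lambda>s. (1 + s) / 2 * log 2 ((1 + s) / 2)) has_real_derivative (log 2 ((1 + x) / 2) + 1 / ln 2) * (1 / 2)) (at x)"
      by (rule DERIV_chain2[where g = "\<lambda>s. (1 + s) / 2", OF g]) (use x in \<open>auto intro!: derivative_eq_intros\<close>)
    have 2: "((\<lambda>s. (1 - s) / 2 * log 2 ((1 - s) / 2)) has_real_derivative (log 2 ((1 - x) / 2) + 1 / ln 2) * (- 1 / 2)) (at x)"
      by (rule DERIV_chain2[where g = "\<lambda>s. (1 - s) / 2", OF g]) (use x in \<open>auto intro!: derivative_eq_intros\<close>)
    have "(bin_ent has_real_derivative - (log 2 ((1 + x) / 2) - log 2 ((1 - x) / 2)) / 2) (at x)"
      unfolding bin_ent_def[abs_def]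
      by (rule DERIV_cong[OF DERIV_minus[OF DERIV_add[OF 1 2]]]) (simp add: algebra_simps)
    moreover have "log 2 ((1 - x) / 2) < log 2 ((1 + x) / 2)" using x by simp
    ultimately show "\<exists>y. (bin_ent has_real_derivative y) (at x) \<and> y < 0" by fastforce
  next
    show "continuous_on {s..t} bin_ent"
      unfolding bin_ent_def[abs_def] log_def using assms False
      by (auto intro!: continuous_intros)
  qed
qed

lemma bin_ent_eq_iff:
  assumes "0 \<le> s" "s \<le> 1" "0 \<le> t" "t \<le> 1"
  shows "bin_ent s = bin_ent t \<longleftrightarrow> s = t"
  using bin_ent_less[of s t] bin_ent_less[of t s] assms by (metis less_irrefl linorder_neqE_linordered_idom)

text \<open>Trace 1 and determinant (1 - s^2)/4 force the eigenvalues (1 + s)/2 and (1 -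
  s)/2.\<close>

lemma vn_entropy_qubit:
  fixes \<rho> :: "complex ^ 2 ^ 2"
  assumes "\<rho> $ 1 $ 1 + \<rho> $ 2 $ 2 = 1" "det \<rho> = of_real ((1 - s\<^sup>2) / 4)"
  shows "vn_entropy \<rho> = bin_ent s"
proof -
  have "char_poly_mat \<rho> = [:\<rho>$1$1 * \<rho>$2$2 - \<rho>$1$2 * \<rho>$2$1, - (\<rho>$1$1 + \<rho>$2$2), 1:]"
    unfolding char_poly_mat_def det_2 by simp
  also have "\<dots> = [:- of_real ((1 + s) / 2), 1:] * [:- of_real ((1 - s) / 2), 1:]"
    using assms(2) unfolding assms(1) det_2[symmetric] by (simp add: field_simps power2_eq_square)
  finally have "char_poly_mat \<rho> = [:- of_real ((1 + s) / 2), 1:] * [:- of_real ((1 - s) / 2), 1:]" .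
  then have "proots (char_poly_mat \<rho>) = {#of_real ((1 + s) / 2), of_real ((1 - s) / 2)#}"
    by (simp add: proots_mult del: mult_pCons_left mult_pCons_right)
  then show ?thesis by (simp add: vn_entropy_def bin_ent_def)
qed

text \<open>An equal mixture of two unit vectors whose overlap has modulus |s| has eigenvalues (1 +
  s)/2, (1 - s)/2, 0, 0. The second assumption is this overlap condition, since
  \<open>phi_plus\<close> has overlap (v11 + v22)/sqrt 2 with \<open>v\<close>.\<close>

lemma vn_entropy_two_qubit:
  fixes v :: qubit2
  assumes "(\<Sum>p\<in>UNIV. v $ p * cnj (v $ p)) = 1"
    "(v $ (1,1) + v $ (2,2)) * cnj (v $ (1,1) + v $ (2,2)) = of_real (2 * s\<^sup>2)"
  shows "vn_entropy ((1 / 2 :: real) *\<^sub>R (ketbra phi_plus phi_plus + ketbra v v)) = bin_ent s" (is "vn_entropy ?\<rho> = _")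
proof -
  define w where "w = complex_of_real (1 / sqrt 2)"
  have w: "w * w = 1 / 2" "cnj w = w" by (simp_all add: w_def flip: of_real_mult)
  have phi: "phi_plus $ (1,1) = w" "phi_plus $ (1,2) = 0" "phi_plus $ (2,1) = 0" "phi_plus $ (2,2) = w"
    by (simp_all add: phi_plus_def ket0_def ket1_def tensor_vec_def) (simp_all add: w_def scaleR_conv_of_real)
  define a b c d where "a = v $ (1,1)" and "b = v $ (1,2)" and "c = v $ (2,1)" and "d = v $ (2,2)"
  \<comment> \<open>Conjugates become independent variables and the capitals carry the weight 1/2,
    so that the determinant is a polynomial identity within reach of \<open>algebra\<close>.\<close>
  define a' b' c' d' where "a' = cnj a" and "b' = cnj b" and "c' = cnj c" and "d' = cnj d"
  define W A B C D where "W = w / 2" and "A = a / 2" and "B = b / 2" and "C = c / 2" and "D = d / 2"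
  have 1: "a * a' + b * b' + c * c' + d * d' = 1"
    using assms(1) by (simp add: UNIV_2x2 a_def b_def c_def d_def a'_def b'_def c'_def d'_def algebra_simps)
  have 2: "(a + d) * (a' + d') = 2 * of_real s ^ 2"
    using assms(2) by (simp add: a_def d_def a'_def d'_def)
  have root_form: "poly (char_poly_mat ?\<rho>) z = z ^ 2 * (z - of_real ((1 + s) / 2)) * (z - of_real ((1 - s) / 2))" for z
  proof -
    have "poly (char_poly_mat ?\<rho>) z = det (\<chi> i j. (if i = j then z else 0) - ?\<rho> $ i $ j)" (is "_ = det ?M")
      by (simp add: char_poly_mat_def det_def poly_sum poly_prod if_distrib[of "\<lambda>p. poly p z"] cong: if_cong)
    \<comment> \<open>The matrix has rank at most two, so only the trace and the sum of the
      principal 2x2 minors survive; the latter is the Gram determinant of the two weighted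
      vectors.\<close>
    also have "\<dots> = z ^ 4 - z ^ 3 * (2 * (W * w) + (A * a' + B * b' + C * c' + D * d'))
       + z ^ 2 * (2 * (W * w) * (A * a' + B * b' + C * c' + D * d') - W * w * (A + D) * (a' + d'))"
    proof -
      have e: "?M $ (1,1) $ (1,1) = z - (W * w + A * a')" "?M $ (1,1) $ (1,2) = - (A * b')"
        "?M $ (1,1) $ (2,1) = - (A * c')" "?M $ (1,1) $ (2,2) = - (W * w + A * d')"
        "?M $ (1,2) $ (1,1) = - (B * a')" "?M $ (1,2) $ (1,2) = z - B * b'"
        "?M $ (1,2) $ (2,1) = - (B * c')" "?M $ (1,2) $ (2,2) = - (B * d')"
        "?M $ (2,1) $ (1,1) = - (C * a')" "?M $ (2,1) $ (1,2) = - (C * b')"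
        "?M $ (2,1) $ (2,1) = z - C * c'" "?M $ (2,1) $ (2,2) = - (C * d')"
        "?M $ (2,2) $ (1,1) = - (W * w + D * a')" "?M $ (2,2) $ (1,2) = - (D * b')"
        "?M $ (2,2) $ (2,1) = - (D * c')" "?M $ (2,2) $ (2,2) = z - (W * w + D * d')"
        by (simp_all add: ketbra_def phi w(2))
          (simp_all add: scaleR_conv_of_real A_def B_def C_def D_def W_def
            a'_def b'_def c'_def d'_def a_def b_def c_def d_def algebra_simps)
      show ?thesis unfolding det_2x2 Let_def e by algebra
    qed
    also have "\<dots> = z ^ 4 - z ^ 3 + z ^ 2 * (1 - of_real s ^ 2) / 4"
    proof -
      have Ww: "W * w = 1 / 4" unfolding W_def times_divide_eq_left w(1) by simp
      have tr: "A * a' + B * b' + C * c' + D * d' = 1 / 2"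
        using 1 by (simp add: A_def B_def C_def D_def flip: add_divide_distrib)
      have "(A + D) * (a' + d') = of_real s ^ 2"
        using 2 by (simp add: A_def D_def flip: add_divide_distrib)
      then have ov: "1 / 4 * (A + D) * (a' + d') = of_real s ^ 2 / 4" by simp
      show ?thesis unfolding Ww tr ov by (simp add: field_simps)
    qed
    finally show ?thesis by (simp add: field_simps power2_eq_square power3_eq_cube power4_eq_xxxx)
  qed
  have "char_poly_mat ?\<rho> = [:0, 1:] * ([:0, 1:] * ([:- of_real ((1 + s) / 2), 1:] * [:- of_real ((1 - s) / 2), 1:]))"
    by (intro poly_eq_poly_eq_iff[THEN iffD1] ext, unfold root_form) (simp add: field_simps power2_eq_square)
  also have "proots \<dots> = {#0, 0, of_real ((1 + s) / 2), of_real ((1 - s) / 2)#}"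
    by (simp add: proots_mult del: mult_pCons_left mult_pCons_right)
  finally show ?thesis by (simp add: vn_entropy_def bin_ent_def)
qed

subsection \<open>Gates and states in coordinates\<close>

text \<open>The normalization |p|^2 + |q|^2 = 1 is left out, so that the generators of the rotations
  and their powers also have this form.\<close>

definition su2 :: "complex \<Rightarrow> complex \<Rightarrow> complex ^ 2 ^ 2"
  where "su2 p q = vector [vector [p, q], vector [- cnj q, cnj p]]"

lemma su2_nth [simp]:
  "su2 p q $ 1 $ 1 = p" "su2 p q $ 1 $ 2 = q" "su2 p q $ 2 $ 1 = - cnj q" "su2 p q $ 2 $ 2 = cnj p"
  by (simp_all add: su2_def)

lemma su2_mult: "su2 p q ** su2 p' q' = su2 (p * p' - q * cnj q') (p * q' + q * cnj p')"
  by (simp add: vec_eq_iff forall_2 matrix_matrix_mult_def sum_2)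

lemma mat2_eq_iff: "(A :: 'a ^ 2 ^ 2) = B \<longleftrightarrow>
    A $ 1 $ 1 = B $ 1 $ 1 \<and> A $ 1 $ 2 = B $ 1 $ 2 \<and> A $ 2 $ 1 = B $ 2 $ 1 \<and> A $ 2 $ 2 = B $ 2 $ 2"
  by (auto simp: vec_eq_iff forall_2)

text \<open>The exponential series is summed entry by entry; the lower row follows from the upper
  one by conjugating convergent series.\<close>

lemma exp_mat_su2:
  assumes "\<And>k. ((**) A ^^ k) (mat 1) = su2 (f k) (g k)"
    and "(\<lambda>k. f k /\<^sub>R fact k) sums p" and "(\<lambda>k. g k /\<^sub>R fact k) sums q"
  shows "exp_mat A = su2 p q"
proof -
  have cnj: "(\<lambda>k. cnj (h k) /\<^sub>R fact k) sums cnj x" if "(\<lambda>k. h k /\<^sub>R fact k) sums x" for h x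
    using bounded_linear.sums[OF bounded_linear_cnj that] by (simp add: scaleR_conv_of_real)
  have "(\<lambda>k. (1 / fact k :: real) *\<^sub>R su2 (f k) (g k)) sums su2 p q"
    unfolding sums_def
  proof (intro vec_tendstoI)
    fix i j :: 2
    consider "i = 1" "j = 1" | "i = 1" "j = 2" | "i = 2" "j = 1" | "i = 2" "j = 2"
      using exhaust_2 by metis
    then show "(\<lambda>n. (\<Sum>k<n. (1 / fact k :: real) *\<^sub>R su2 (f k) (g k)) $ i $ j) \<longlonglongrightarrow> su2 p q $ i $ j"
      using assms(2,3) cnj[OF assms(2)] sums_minus[OF cnj[OF assms(3)]]
      by cases (simp_all add: sums_def divide_inverse)
  qed
  then show ?thesis unfolding exp_mat_def assms(1) by (rule sums_unique[symmetric])
qed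

lemma rot_Z: "rot_Z \<xi> = su2 (cis \<xi>) 0"
  unfolding rot_Z_def
proof (rule exp_mat_su2)
  let ?A = "mat (\<i> * complex_of_real \<xi>) ** sigma_z"
  show "((**) ?A ^^ k) (mat 1) = su2 ((\<i> * of_real \<xi>) ^ k) 0" for k
  proof (induction k)
    case (Suc k)
    have "?A = su2 (\<i> * of_real \<xi>) 0"
      by (simp add: mat2_eq_iff matrix_matrix_mult_def sum_2 sigma_z_def mat_def)
    then show ?case using Suc by (simp add: su2_mult)
  qed (simp add: mat2_eq_iff mat_def)
  show "(\<lambda>k. (\<i> * of_real \<xi>) ^ k /\<^sub>R fact k) sums cis \<xi>"
    unfolding cis_conv_exp by (rule exp_converges)
qed simp

text \<open>The generator is \<open>su2 0 \<xi>\<close>, and real matrices \<open>su2 x y\<close>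
  multiply like the complex numbers x + iy. Its powers are therefore those of i\<xi>, and cosine and
  sine arise as real and imaginary parts of the exponential.\<close>

lemma rot_Y: "rot_Y \<xi> = su2 (cos \<xi>) (sin \<xi>)"
  unfolding rot_Y_def
proof (rule exp_mat_su2)
  let ?A = "mat (\<i> * complex_of_real \<xi>) ** sigma_y"
  let ?z = "\<lambda>k. (\<i> * of_real \<xi>) ^ k"
  show "((**) ?A ^^ k) (mat 1) = su2 (of_real (Re (?z k))) (of_real (Im (?z k)))" for k
  proof (induction k)
    case (Suc k)
    have "?A = su2 0 (of_real \<xi>)"
      by (simp add: mat2_eq_iff matrix_matrix_mult_def sum_2 sigma_y_def mat_def complex_eq_iff)
    then show ?case using Suc by (simp add: su2_mult)
  qed (simp add: mat2_eq_iff mat_def)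
  have z: "(\<lambda>k. ?z k /\<^sub>R fact k) sums cis \<xi>"
    unfolding cis_conv_exp by (rule exp_converges)
  show "(\<lambda>k. complex_of_real (Re (?z k)) /\<^sub>R fact k) sums of_real (cos \<xi>)"
    using sums_of_real[OF sums_Re[OF z], where 'a = complex] by (simp add: scaleR_conv_of_real[of _ "of_real _"])
  show "(\<lambda>k. complex_of_real (Im (?z k)) /\<^sub>R fact k) sums of_real (sin \<xi>)"
    using sums_of_real[OF sums_Im[OF z], where 'a = complex] by (simp add: scaleR_conv_of_real[of _ "of_real _"])
qed

lemma U2_su2:
  "U2 D = su2 (cis (par_alpha D + par_gamma D) * cos (par_beta D)) (cis (par_alpha D - par_gamma D) * sin (par_beta D))"
proof -
  have "cis (par_alpha D + par_gamma D) = cis (par_alpha D) * cis (par_gamma D)"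
    "cis (par_alpha D - par_gamma D) = cis (par_alpha D) * cis (- par_gamma D)"
    by (simp_all add: cis_mult)
  then show ?thesis by (simp add: U2_def rot_Z rot_Y su2_mult cis_cnj mult_ac)
qed

lemma U3_su2: "U3 D = su2 (cos (par_beta' D)) (sin (par_beta' D))"
  by (simp add: U3_def rot_Y)

section \<open>Coordinates of the seed state and of the controlled gates\<close>

lemma psi_s_nth [simp]:
  "psi_s D $ (1,1) = par_a D" "psi_s D $ (1,2) = 0" "psi_s D $ (2,1) = 0" "psi_s D $ (2,2) = par_b D"
  by (simp_all add: psi_s_def tensor_vec_def ket0_def ket1_def) (simp_all add: scaleR_conv_of_real)

lemma ket_plus_nth [simp]: "ket_plus $ 1 = of_real (1 / sqrt 2)" "ket_plus $ 2 = of_real (1 / sqrt 2)"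
  by (simp_all add: ket_plus_def ket0_def ket1_def)  (simp_all add: scaleR_conv_of_real)

lemma ctrl12_mult_vec:
  "(ctrl12 U *v x) $ (1, j, k) = x $ (1, j, k)"
  "(ctrl12 U *v x) $ (2, j, k) = (\<Sum>j'\<in>UNIV. U $ j $ j' * x $ (2, j', k))"
  using exhaust_2[of j] exhaust_2[of k]
  by (auto simp: ctrl12_def matrix_vector_mult_def sum_prod_UNIV sum_2 tensor_mat_def ketbra_def ket0_def ket1_def mat_def)

lemma ctrl13_mult_vec:
  "(ctrl13 U *v x) $ (1, j, k) = x $ (1, j, k)"
  "(ctrl13 U *v x) $ (2, j, k) = (\<Sum>k'\<in>UNIV. U $ k $ k' * x $ (2, j, k'))"
  using exhaust_2[of j] exhaust_2[of k]
  by (auto simp: ctrl13_def matrix_vector_mult_def sum_prod_UNIV sum_2 tensor_mat_def ketbra_def ket0_def ket1_def mat_def)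

lemma tensor_mat_mult_vec:
  "((A \<otimes>\<^sub>m B \<otimes>\<^sub>m C) *v x) $ (i, j, k) =
    (\<Sum>i'\<in>UNIV. \<Sum>j'\<in>UNIV. \<Sum>k'\<in>UNIV. A $ i $ i' * B $ j $ j' * C $ k $ k' * x $ (i', j', k'))"
  by (simp add: matrix_vector_mult_def sum_prod_UNIV tensor_mat_def mult.assoc)

text \<open>\<open>pair_state a b U0 W0 U1 W1\<close> is \<open>(|0\<rangle> (U0 \<otimes> W0)|\<psi>\<^sub>s\<rangle> + |1\<rangle> (U1 \<otimes> W1)|\<psi>\<^sub>s\<rangle>) / \<surd>2\<close>.\<close>

definition pair_state ::
    "real \<Rightarrow> real \<Rightarrow> complex^2^2 \<Rightarrow> complex^2^2 \<Rightarrow> complex^2^2 \<Rightarrow> complex^2^2 \<Rightarrow> qubit3"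
  where "pair_state a b U0 W0 U1 W1 = (\<chi> l. case l of (i, j, k) \<Rightarrow> of_real (1 / sqrt 2) *
    (if i = 1 then a * U0 $ j $ 1 * W0 $ k $ 1 + b * U0 $ j $ 2 * W0 $ k $ 2
     else a * U1 $ j $ 1 * W1 $ k $ 1 + b * U1 $ j $ 2 * W1 $ k $ 2))"

abbreviation ctrl_state :: "real \<Rightarrow> real \<Rightarrow> complex^2^2 \<Rightarrow> complex^2^2 \<Rightarrow> qubit3"
  where "ctrl_state a b U W \<equiv> pair_state a b (mat 1) (mat 1) U W"

lemma qubit3_eq_iff: "(x :: qubit3) = y \<longleftrightarrow> (\<forall>j k. x $ (1, j, k) = y $ (1, j, k)) \<and> (\<forall>j k. x $ (2, j, k) = y $ (2, j, k))"
  by (simp add: vec_eq_iff forall_2)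

text \<open>\<open>P\<close> acts before the controlled gates and thus enters both branches; with
  Pauli matrices for \<open>P\<close> this covers the elements of \<open>S_D\<close>.\<close>

lemma ctrl_gates_eq_pair_state:
  "(ctrl13 W ** ctrl12 U ** (mat 1 \<otimes>\<^sub>m P \<otimes>\<^sub>m mat 1)) *v (ket_plus \<otimes>\<^sub>v psi_s D) =
    pair_state (par_a D) (par_b D) P (mat 1) (U ** P) W"
  unfolding matrix_vector_mul_assoc[symmetric] qubit3_eq_iff forall_2 ctrl13_mult_vec ctrl12_mult_vec
  by (simp add: tensor_mat_mult_vec sum_2 pair_state_def tensor_vec_def matrix_matrix_mult_def mat_def add_divide_distrib algebra_simps)

lemma psi_D_eq: "psi_D D = ctrl_state (par_a D) (par_b D) (U2 D) (U3 D)"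
  unfolding psi_D_def matrix_vector_mul_assoc[symmetric] qubit3_eq_iff forall_2 ctrl13_mult_vec ctrl12_mult_vec
  by (simp add: sum_2 pair_state_def tensor_vec_def mat_def add_divide_distrib algebra_simps)

subsection \<open>The five measures as functions of the gate entries\<close>

text \<open>The reduced state is diagonal with eigenvalues a^2 and b^2.\<close>

lemma E1_value:
  assumes "(par_a D)\<^sup>2 + (par_b D)\<^sup>2 = 1"
  shows "E1 D = bin_ent ((par_a D)\<^sup>2 - (par_b D)\<^sup>2)"
  unfolding E1_def entanglement_def
proof (rule vn_entropy_qubit)
  have r: "reduced_state (psi_s D) $ 1 $ 1 = of_real ((par_a D)\<^sup>2)" "reduced_state (psi_s D) $ 1 $ 2 = 0"
    "reduced_state (psi_s D) $ 2 $ 1 = 0" "reduced_state (psi_s D) $ 2 $ 2 = of_real ((par_b D)\<^sup>2)"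
    by (simp_all add: reduced_state_def ketbra_def sum_2 power2_eq_square)
  show "reduced_state (psi_s D) $ 1 $ 1 + reduced_state (psi_s D) $ 2 $ 2 = 1"
    unfolding r by (metis assms of_real_1 of_real_add)
  have "(par_a D)\<^sup>2 * (par_b D)\<^sup>2 = (1 - ((par_a D)\<^sup>2 - (par_b D)\<^sup>2)\<^sup>2) / 4"
    using assms by (simp add: field_simps power2_eq_square) algebra
  then show "det (reduced_state (psi_s D)) = of_real ((1 - ((par_a D)\<^sup>2 - (par_b D)\<^sup>2)\<^sup>2) / 4)"
    unfolding det_2 r by (metis diff_zero mult_zero_left of_real_mult)
qed

text \<open>The overlap of \<open>phi_plus\<close> with its image under U on the first factor is
  half the trace of U, that is \<open>Re p\<close>.\<close>

lemma gate_entropy_su2: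
  assumes "p * cnj p + q * cnj q = 1"
  shows "gate_entropy (su2 p q) = bin_ent \<bar>Re p\<bar>"
proof -
  define v where "v = (su2 p q \<otimes>\<^sub>m mat 1) *v phi_plus"
  have conj: "A ** ketbra u u ** adjoint_mat A = ketbra (A *v u) (A *v u)" for A :: "complex^'n^'n" and u
    by (simp add: vec_eq_iff matrix_matrix_mult_def matrix_vector_mult_def ketbra_def adjoint_mat_def
        sum_distrib_left sum_distrib_right mult.assoc mult.commute mult.left_commute)
  have phi: "phi_plus $ (1,1) = of_real (1 / sqrt 2)" "phi_plus $ (1,2) = 0" "phi_plus $ (2,1) = 0" "phi_plus $ (2,2) = of_real (1 / sqrt 2)"
    by (simp_all add: phi_plus_def ket0_def ket1_def tensor_vec_def) (simp_all add: scaleR_conv_of_real)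
  have w: "complex_of_real (1 / sqrt 2) * complex_of_real (1 / sqrt 2) = 1 / 2"
    by (simp flip: of_real_mult)
  have v: "v $ (1,1) = p * of_real (1 / sqrt 2)" "v $ (1,2) = q * of_real (1 / sqrt 2)"
    "v $ (2,1) = - cnj q * of_real (1 / sqrt 2)" "v $ (2,2) = cnj p * of_real (1 / sqrt 2)"
    by (simp_all only: v_def matrix_vector_mult_def sum_prod_UNIV sum_2)
      (simp_all add: tensor_mat_def mat_def phi)
  have "vn_entropy ((1 / 2 :: real) *\<^sub>R (ketbra phi_plus phi_plus + ketbra v v)) = bin_ent \<bar>Re p\<bar>"
  proof (rule vn_entropy_two_qubit)
    have "(\<Sum>p\<in>UNIV. v $ p * cnj (v $ p)) = 2 * (p * cnj p + q * cnj q) * (of_real (1 / sqrt 2) * of_real (1 / sqrt 2))"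
      unfolding UNIV_2x2 by (simp add: v algebra_simps)
    then show "(\<Sum>p\<in>UNIV. v $ p * cnj (v $ p)) = 1" unfolding w assms by simp
    have "(v $ (1,1) + v $ (2,2)) * cnj (v $ (1,1) + v $ (2,2)) =
       (p + cnj p) * (p + cnj p) * (of_real (1 / sqrt 2) * of_real (1 / sqrt 2))"
      by (simp add: v algebra_simps)
    then show "(v $ (1,1) + v $ (2,2)) * cnj (v $ (1,1) + v $ (2,2)) = of_real (2 * \<bar>Re p\<bar>\<^sup>2)"
      unfolding w by (simp add: complex_add_cnj power2_eq_square)
  qed
  then show ?thesis by (simp add: gate_entropy_def conj v_def)
qed

text \<open>The reduced state of the first qubit consists of the inner products of the two branches;
  the assumptions give its trace and determinant.\<close>

lemma entanglement_qubit:
  fixes \<psi> :: "complex ^ (2 \<times> 'n::finite)"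
  assumes "(\<Sum>k\<in>UNIV. \<psi> $ (1,k) * cnj (\<psi> $ (1,k))) + (\<Sum>k\<in>UNIV. \<psi> $ (2,k) * cnj (\<psi> $ (2,k))) = 1"
    and "(\<Sum>k\<in>UNIV. \<psi> $ (1,k) * cnj (\<psi> $ (1,k))) * (\<Sum>k\<in>UNIV. \<psi> $ (2,k) * cnj (\<psi> $ (2,k))) -
     (\<Sum>k\<in>UNIV. \<psi> $ (1,k) * cnj (\<psi> $ (2,k))) * (\<Sum>k\<in>UNIV. \<psi> $ (2,k) * cnj (\<psi> $ (1,k))) = of_real ((1 - s\<^sup>2) / 4)"
  shows "entanglement \<psi> = bin_ent s"
  unfolding entanglement_def using assms
  by (intro vn_entropy_qubit) (simp_all add: reduced_state_def ketbra_def det_2)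

text \<open>Both branches have weight 1/2, so the entropy depends on their overlap alone. Up to
  conjugation this is a^2 p + b^2 \<open>cnj p\<close>, with real part \<open>Re p\<close> and
  imaginary part (a^2 - b^2) \<open>Im p\<close>.\<close>

lemma E4_value:
  assumes "(par_a D)\<^sup>2 + (par_b D)\<^sup>2 = 1" "U2 D = su2 p q" "p * cnj p + q * cnj q = 1"
  shows "E4 D = bin_ent (sqrt ((Re p)\<^sup>2 + ((par_a D)\<^sup>2 - (par_b D)\<^sup>2)\<^sup>2 * (Im p)\<^sup>2))"
  unfolding E4_def
proof (rule entanglement_qubit)
  define a b w where "a = complex_of_real (par_a D)" and "b = complex_of_real (par_b D)" and "w = complex_of_real (1 / sqrt 2)"
  have w: "w * w = 1 / 2" by (simp add: w_def flip: of_real_mult)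
  have ab: "a * a + b * b = 1" using assms(1) by (simp add: a_def b_def power2_eq_square flip: of_real_mult of_real_add)
  let ?\<psi> = "ctrl12 (U2 D) *v (ket_plus \<otimes>\<^sub>v psi_s D)"
  have nth: "?\<psi> $ (1,1,1) = w * a" "?\<psi> $ (1,1,2) = 0" "?\<psi> $ (1,2,1) = 0" "?\<psi> $ (1,2,2) = w * b"
     "?\<psi> $ (2,1,1) = w * (a * p)" "?\<psi> $ (2,1,2) = w * (b * q)" "?\<psi> $ (2,2,1) = - w * (a * cnj q)" "?\<psi> $ (2,2,2) = w * (b * cnj p)"
    unfolding ctrl12_mult_vec by (simp_all add: sum_2 tensor_vec_def assms(2) a_def b_def w_def)
  have [simp]: "cnj a = a" "cnj b = b" "cnj w = w" by (simp_all add: a_def b_def w_def)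
  have 1: "(\<Sum>k\<in>UNIV. ?\<psi> $ (1,k) * cnj (?\<psi> $ (1,k))) = 1 / 2"
  proof -
    have "(\<Sum>k\<in>UNIV. ?\<psi> $ (1,k) * cnj (?\<psi> $ (1,k))) = w * w * (a * a + b * b)"
      by (simp add: sum_prod_UNIV sum_2 nth algebra_simps)
    then show ?thesis by (simp add: w ab)
  qed
  have 2: "(\<Sum>k\<in>UNIV. ?\<psi> $ (2,k) * cnj (?\<psi> $ (2,k))) = 1 / 2"
  proof -
    have "(\<Sum>k\<in>UNIV. ?\<psi> $ (2,k) * cnj (?\<psi> $ (2,k))) = w * w * ((a * a + b * b) * (p * cnj p + q * cnj q))"
      by (simp add: sum_prod_UNIV sum_2 nth algebra_simps)
    then show ?thesis by (simp add: w ab assms(3))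
  qed
  have 3: "(\<Sum>k\<in>UNIV. ?\<psi> $ (1,k) * cnj (?\<psi> $ (2,k))) = w * w * (a * a * cnj p + b * b * p)"
    "(\<Sum>k\<in>UNIV. ?\<psi> $ (2,k) * cnj (?\<psi> $ (1,k))) = w * w * (a * a * p + b * b * cnj p)"
    by (simp_all add: sum_prod_UNIV sum_2 nth algebra_simps)
  show "(\<Sum>k\<in>UNIV. ?\<psi> $ (1,k) * cnj (?\<psi> $ (1,k))) + (\<Sum>k\<in>UNIV. ?\<psi> $ (2,k) * cnj (?\<psi> $ (2,k))) = 1"
    unfolding 1 2 by simp
  define x y where "x = complex_of_real (Re p)" and "y = complex_of_real (Im p)"
  have p: "p = x + \<i> * y" "cnj p = x - \<i> * y" by (simp_all add: x_def y_def complex_eq_iff)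
  have [simp]: "cnj x = x" "cnj y = y" by (simp_all add: x_def y_def)
  have "(a * a * cnj p + b * b * p) * (a * a * p + b * b * cnj p) = x ^ 2 * (a * a + b * b) ^ 2 + (a * a - b * b)\<^sup>2 * y\<^sup>2"
    unfolding p by (simp add: algebra_simps power2_eq_square)
  then have *: "(a * a * cnj p + b * b * p) * (a * a * p + b * b * cnj p) = x ^ 2 + (a * a - b * b)\<^sup>2 * y\<^sup>2"
    by (simp add: ab)
  show "(\<Sum>k\<in>UNIV. ?\<psi> $ (1,k) * cnj (?\<psi> $ (1,k))) * (\<Sum>k\<in>UNIV. ?\<psi> $ (2,k) * cnj (?\<psi> $ (2,k))) -
     (\<Sum>k\<in>UNIV. ?\<psi> $ (1,k) * cnj (?\<psi> $ (2,k))) * (\<Sum>k\<in>UNIV. ?\<psi> $ (2,k) * cnj (?\<psi> $ (1,k))) =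
     of_real ((1 - (sqrt ((Re p)\<^sup>2 + ((par_a D)\<^sup>2 - (par_b D)\<^sup>2)\<^sup>2 * (Im p)\<^sup>2))\<^sup>2) / 4)"
  proof -
    have sq: "of_real ((sqrt ((Re p)\<^sup>2 + ((par_a D)\<^sup>2 - (par_b D)\<^sup>2)\<^sup>2 * (Im p)\<^sup>2))\<^sup>2) = x ^ 2 + (a * a - b * b)\<^sup>2 * y\<^sup>2"
      by (simp add: x_def y_def a_def b_def power2_eq_square)
    have half: "1 / 2 * (1 / 2) - 1 / 2 * A * (1 / 2 * B) = (1 - A * B) / 4" for A B :: complex
      by (simp add: field_simps)
    show ?thesis unfolding 1 2 3 w of_real_divide of_real_diff sq half * by simp
  qed
qed

text \<open>Qubit 1 is in |+> with weight a^2 and in U|+> with weight b^2, which gives determinant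
  a^2 b^2 (1 - |o|^2) for the overlap o = <+|U|+> = \<open>Re p\<close> + i
  \<open>Im q\<close>.\<close>

lemma E5_value:
  assumes "(par_a D)\<^sup>2 + (par_b D)\<^sup>2 = 1" "U2 D = su2 p q" "p * cnj p + q * cnj q = 1"
  shows "E5 D = bin_ent (sqrt (1 - 4 * (par_a D)\<^sup>2 * (par_b D)\<^sup>2 * (1 - (Re p)\<^sup>2 - (Im q)\<^sup>2)))"
  unfolding E5_def
proof (rule entanglement_qubit)
  define a b w where "a = complex_of_real (par_a D)" and "b = complex_of_real (par_b D)" and "w = complex_of_real (1 / sqrt 2)"
  have w: "w * w = 1 / 2" by (simp add: w_def flip: of_real_mult)
  have ab: "a * a + b * b = 1" using assms(1) by (simp add: a_def b_def power2_eq_square flip: of_real_mult of_real_add)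
  let ?\<psi> = "par_a D *\<^sub>R (ket_plus \<otimes>\<^sub>v ket0 \<otimes>\<^sub>v ket0)
     + par_b D *\<^sub>R ((U2 D *v ket_plus) \<otimes>\<^sub>v ket1 \<otimes>\<^sub>v ket1)"
  \<comment> \<open>The entries of \<open>U2 D *v ket_plus\<close>, scaled by sqrt 2.\<close>
  define P Q where "P = p + q" and "Q = cnj p - cnj q"
  have nth: "?\<psi> $ (1,1,1) = w * a" "?\<psi> $ (1,1,2) = 0" "?\<psi> $ (1,2,1) = 0" "?\<psi> $ (1,2,2) = w * (b * P)"
     "?\<psi> $ (2,1,1) = w * a" "?\<psi> $ (2,1,2) = 0" "?\<psi> $ (2,2,1) = 0" "?\<psi> $ (2,2,2) = w * (b * Q)"
    by (simp_all add: tensor_vec_def ket0_def ket1_def matrix_vector_mult_def sum_2)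
      (simp_all add: assms(2) a_def b_def w_def P_def Q_def scaleR_conv_of_real algebra_simps)
  have [simp]: "cnj a = a" "cnj b = b" "cnj w = w" by (simp_all add: a_def b_def w_def)
  have s: "(\<Sum>k\<in>UNIV. ?\<psi> $ (1,k) * cnj (?\<psi> $ (1,k))) = w * w * (a * a + b * b * (P * cnj P))"
    "(\<Sum>k\<in>UNIV. ?\<psi> $ (2,k) * cnj (?\<psi> $ (2,k))) = w * w * (a * a + b * b * (Q * cnj Q))"
    "(\<Sum>k\<in>UNIV. ?\<psi> $ (1,k) * cnj (?\<psi> $ (2,k))) = w * w * (a * a + b * b * (P * cnj Q))"
    "(\<Sum>k\<in>UNIV. ?\<psi> $ (2,k) * cnj (?\<psi> $ (1,k))) = w * w * (a * a + b * b * (Q * cnj P))"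
    unfolding sum_prod_UNIV sum_2 nth by (simp_all add: algebra_simps)
  have PQ: "P * cnj P + Q * cnj Q = 2" using assms(3) by (simp add: P_def Q_def algebra_simps)
  show "(\<Sum>k\<in>UNIV. ?\<psi> $ (1,k) * cnj (?\<psi> $ (1,k))) + (\<Sum>k\<in>UNIV. ?\<psi> $ (2,k) * cnj (?\<psi> $ (2,k))) = 1"
  proof -
    have "1 / 2 * (a * a + b * b * (P * cnj P)) + 1 / 2 * (a * a + b * b * (Q * cnj Q)) =
        a * a + b * b * ((P * cnj P + Q * cnj Q) / 2)"
      by (simp add: field_simps)
    then show ?thesis unfolding s w PQ using ab by simp
  qed
  \<comment> \<open>The determinant involves the mixed products only through their sum, which is
    read off from |P + Q|^2.\<close>
  have "(P + Q) * cnj (P + Q) = of_real (4 * (Re p)\<^sup>2 + 4 * (Im q)\<^sup>2)"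
    by (simp add: P_def Q_def complex_eq_iff power2_eq_square algebra_simps)
  moreover have "(P + Q) * cnj (P + Q) = 2 + (P * cnj Q + Q * cnj P)"
    unfolding PQ[symmetric] by (simp add: algebra_simps)
  ultimately have "P * cnj Q + Q * cnj P = of_real (4 * (Re p)\<^sup>2 + 4 * (Im q)\<^sup>2) - 2"
    by (metis add_diff_cancel_left')
  then have *: "(a * a + b * b * (P * cnj P)) * (a * a + b * b * (Q * cnj Q)) -
     (a * a + b * b * (P * cnj Q)) * (a * a + b * b * (Q * cnj P)) =
     4 * (a * a) * (b * b) * (1 - of_real ((Re p)\<^sup>2) - of_real ((Im q)\<^sup>2))"
    using PQ unfolding of_real_add of_real_mult of_real_numeral by algebra
  have "(Re p)\<^sup>2 + (Im p)\<^sup>2 + (Re q)\<^sup>2 + (Im q)\<^sup>2 = 1"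
    using assms(3) by (simp add: complex_eq_iff power2_eq_square)
  \<comment> \<open>These bounds make the radicand nonnegative, so that squaring undoes the
    root.\<close>
  then have le: "0 \<le> 1 - (Re p)\<^sup>2 - (Im q)\<^sup>2" "1 - (Re p)\<^sup>2 - (Im q)\<^sup>2 \<le> 1"
    using zero_le_power2[of "Re p"] zero_le_power2[of "Im p"] zero_le_power2[of "Re q"] zero_le_power2[of "Im q"]
    by linarith+
  have K: "4 * (par_a D)\<^sup>2 * (par_b D)\<^sup>2 = 1 - ((par_a D)\<^sup>2 - (par_b D)\<^sup>2)\<^sup>2"
    using assms(1) by algebra
  have "4 * (par_a D)\<^sup>2 * (par_b D)\<^sup>2 * (1 - (Re p)\<^sup>2 - (Im q)\<^sup>2) \<le> 1"
    by (rule mult_le_one[OF _ le]) (simp add: K)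
  then have sq: "(sqrt (1 - 4 * (par_a D)\<^sup>2 * (par_b D)\<^sup>2 * (1 - (Re p)\<^sup>2 - (Im q)\<^sup>2)))\<^sup>2 =
      1 - 4 * (par_a D)\<^sup>2 * (par_b D)\<^sup>2 * (1 - (Re p)\<^sup>2 - (Im q)\<^sup>2)"
    by (intro real_sqrt_pow2) simp
  have half: "1 / 2 * A * (1 / 2 * B) - 1 / 2 * A' * (1 / 2 * B') = (A * B - A' * B') / 4" for A B A' B' :: complex
    by (simp add: field_simps)
  show "(\<Sum>k\<in>UNIV. ?\<psi> $ (1,k) * cnj (?\<psi> $ (1,k))) * (\<Sum>k\<in>UNIV. ?\<psi> $ (2,k) * cnj (?\<psi> $ (2,k))) -
     (\<Sum>k\<in>UNIV. ?\<psi> $ (1,k) * cnj (?\<psi> $ (2,k))) * (\<Sum>k\<in>UNIV. ?\<psi> $ (2,k) * cnj (?\<psi> $ (1,k))) =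
     of_real ((1 - (sqrt (1 - 4 * (par_a D)\<^sup>2 * (par_b D)\<^sup>2 * (1 - (Re p)\<^sup>2 - (Im q)\<^sup>2)))\<^sup>2) / 4)"
    unfolding s w half * sq by (simp add: a_def b_def power2_eq_square)
qed

subsection \<open>Local unitary equivalence\<close>

lemma tensor_mat_mult: "(A \<otimes>\<^sub>m B) ** (A' \<otimes>\<^sub>m B') = (A ** A') \<otimes>\<^sub>m (B ** B')"
  by (simp add: vec_eq_iff matrix_matrix_mult_def tensor_mat_def sum_prod_UNIV sum_product mult_ac)

lemma tensor_mat_1: "mat 1 \<otimes>\<^sub>m mat 1 = mat 1"
  by (auto simp: vec_eq_iff tensor_mat_def mat_def)

lemma unitary_mat_1 [simp]: "unitary_mat (mat 1)"
proof -
  have "adjoint_mat (mat 1) = mat 1" by (auto simp: vec_eq_iff adjoint_mat_def mat_def)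
  then show ?thesis by (simp add: unitary_mat_def)
qed

lemma unitary_mat_adjoint: "unitary_mat U \<Longrightarrow> unitary_mat (adjoint_mat U)"
proof -
  have "adjoint_mat (adjoint_mat U) = U" by (simp add: vec_eq_iff adjoint_mat_def)
  then show "unitary_mat U \<Longrightarrow> unitary_mat (adjoint_mat U)" by (simp add: unitary_mat_def)
qed

lemma unitary_mat_mult:
  assumes "unitary_mat U" "unitary_mat V" shows "unitary_mat (U ** V)"
proof -
  have *: "adjoint_mat (U ** V) = adjoint_mat V ** adjoint_mat U"
    by (simp add: vec_eq_iff adjoint_mat_def matrix_matrix_mult_def mult.commute)
  have "adjoint_mat V ** adjoint_mat U ** (U ** V) = adjoint_mat V ** (adjoint_mat U ** U) ** V"
    "U ** V ** (adjoint_mat V ** adjoint_mat U) = U ** (V ** adjoint_mat V) ** adjoint_mat U"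
    by (simp_all only: matrix_mul_assoc)
  then show ?thesis using assms by (simp add: unitary_mat_def *)
qed

lemma LU_equivalentI:
  assumes "unitary_mat V1" "unitary_mat V2" "unitary_mat V3"
  shows "LU_equivalent ((V1 \<otimes>\<^sub>m V2 \<otimes>\<^sub>m V3) *v \<psi>) \<psi>"
  using assms unfolding LU_equivalent_def by blast

section \<open>LU equivalence is an equivalence relation\<close>

lemma LU_equivalent_refl [simp]: "LU_equivalent \<psi> \<psi>"
  using LU_equivalentI[of "mat 1" "mat 1" "mat 1" \<psi>] by (simp add: tensor_mat_1)

lemma LU_equivalent_sym:
  assumes "LU_equivalent \<phi> \<psi>" shows "LU_equivalent \<psi> \<phi>"
proof -
  obtain V1 V2 V3 where V: "unitary_mat V1" "unitary_mat V2" "unitary_mat V3"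
    and \<phi>: "\<phi> = (V1 \<otimes>\<^sub>m V2 \<otimes>\<^sub>m V3) *v \<psi>" using assms by (auto simp: LU_equivalent_def)
  have "(adjoint_mat V1 \<otimes>\<^sub>m adjoint_mat V2 \<otimes>\<^sub>m adjoint_mat V3) *v \<phi> = \<psi>"
    using V by (simp add: \<phi> matrix_vector_mul_assoc tensor_mat_mult unitary_mat_def tensor_mat_1)
  then show ?thesis using LU_equivalentI V unitary_mat_adjoint by metis
qed

lemma LU_equivalent_trans [trans]:
  assumes "LU_equivalent \<phi> \<psi>" "LU_equivalent \<psi> \<omega>" shows "LU_equivalent \<phi> \<omega>"
proof -
  obtain V1 V2 V3 where V: "unitary_mat V1" "unitary_mat V2" "unitary_mat V3"
    and \<phi>: "\<phi> = (V1 \<otimes>\<^sub>m V2 \<otimes>\<^sub>m V3) *v \<psi>" using assms by (auto simp: LU_equivalent_def)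
  obtain W1 W2 W3 where W: "unitary_mat W1" "unitary_mat W2" "unitary_mat W3"
    and \<psi>: "\<psi> = (W1 \<otimes>\<^sub>m W2 \<otimes>\<^sub>m W3) *v \<omega>" using assms by (auto simp: LU_equivalent_def)
  have "\<phi> = ((V1 ** W1) \<otimes>\<^sub>m (V2 ** W2) \<otimes>\<^sub>m (V3 ** W3)) *v \<omega>"
    by (simp add: \<phi> \<psi> matrix_vector_mul_assoc tensor_mat_mult)
  then show ?thesis using LU_equivalentI V W unitary_mat_mult by metis
qed

lemma LU_equivalent_right_cong:
  assumes "LU_equivalent \<phi> \<psi>" shows "LU_equivalent \<omega> \<phi> \<longleftrightarrow> LU_equivalent \<omega> \<psi>"
  using assms LU_equivalent_sym[OF assms] LU_equivalent_trans[of \<omega>] by blast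

lemma unitary_su2:
  assumes "p * cnj p + q * cnj q = 1" shows "unitary_mat (su2 p q)"
proof -
  have "adjoint_mat (su2 p q) = su2 (cnj p) (- q)"
    by (simp add: mat2_eq_iff adjoint_mat_def)
  then show ?thesis using assms
    unfolding unitary_mat_def by (simp add: su2_mult mult.commute add.commute) (simp add: mat2_eq_iff mat_def)
qed

lemma sigma_nth [simp]:
  "sigma_x $ 1 $ 1 = 0" "sigma_x $ 1 $ 2 = 1" "sigma_x $ 2 $ 1 = 1" "sigma_x $ 2 $ 2 = 0"
  "sigma_y $ 1 $ 1 = 0" "sigma_y $ 1 $ 2 = - \<i>" "sigma_y $ 2 $ 1 = \<i>" "sigma_y $ 2 $ 2 = 0"
  "sigma_z $ 1 $ 1 = 1" "sigma_z $ 1 $ 2 = 0" "sigma_z $ 2 $ 1 = 0" "sigma_z $ 2 $ 2 = - 1"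
  by (simp_all add: sigma_x_def sigma_y_def sigma_z_def)

lemma unitary_sigma: "unitary_mat sigma_x" "unitary_mat sigma_y" "unitary_mat sigma_z"
  by (simp_all add: unitary_mat_def mat2_eq_iff adjoint_mat_def matrix_matrix_mult_def sum_2 mat_def)

lemma unitary_phase_gate:
  assumes "cmod z = 1" shows "unitary_mat (vector [vector [1, 0], vector [0, z]] :: complex ^ 2 ^ 2)"
proof -
  have "z * cnj z = 1" using assms by (simp add: complex_norm_square[symmetric])
  then show ?thesis
    unfolding unitary_mat_def mat2_eq_iff
    by (simp add: adjoint_mat_def matrix_matrix_mult_def sum_2 mat_def mult.commute)
qed

section \<open>Local unitary moves on pair states\<close>

lemma LU_pair_state_mult:
  assumes "unitary_mat A" "unitary_mat B"
  shows "LU_equivalent (pair_state a b (A ** U0) (B ** W0) (A ** U1) (B ** W1)) (pair_state a b U0 W0 U1 W1)"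
proof -
  have "(mat 1 \<otimes>\<^sub>m A \<otimes>\<^sub>m B) *v pair_state a b U0 W0 U1 W1 = pair_state a b (A ** U0) (B ** W0) (A ** U1) (B ** W1)"
    unfolding qubit3_eq_iff forall_2 tensor_mat_mult_vec
    by (simp add: pair_state_def matrix_matrix_mult_def mat_def sum_2 algebra_simps add_divide_distrib)
  then show ?thesis using LU_equivalentI[OF unitary_mat_1 assms] by metis
qed

lemma LU_pair_state_swap:
  "LU_equivalent (pair_state a b U1 W1 U0 W0) (pair_state a b U0 W0 U1 W1)"
proof -
  have "(sigma_x \<otimes>\<^sub>m mat 1 \<otimes>\<^sub>m mat 1) *v pair_state a b U0 W0 U1 W1 = pair_state a b U1 W1 U0 W0"
    unfolding qubit3_eq_iff forall_2 tensor_mat_mult_vec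
    by (simp add: pair_state_def mat_def sum_2)
  then show ?thesis using LU_equivalentI[OF unitary_sigma(1) unitary_mat_1 unitary_mat_1] by metis
qed

text \<open>\<open>sigma_z\<close> on qubit 1 flips the sign of the branch |1>, which is absorbed
  into the gate.\<close>

lemma LU_ctrl_neg: "LU_equivalent (ctrl_state a b (su2 (- p) (- q)) W) (ctrl_state a b (su2 p q) W)"
proof -
  have "(sigma_z \<otimes>\<^sub>m mat 1 \<otimes>\<^sub>m mat 1) *v ctrl_state a b (su2 p q) W = ctrl_state a b (su2 (- p) (- q)) W"
    unfolding qubit3_eq_iff forall_2 tensor_mat_mult_vec
    by (simp add: pair_state_def mat_def sum_2 algebra_simps)
  then show ?thesis using LU_equivalentI[OF unitary_sigma(3) unitary_mat_1 unitary_mat_1] by metis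
qed

text \<open>
  Exchange \<open>|0\<rangle>\<close> and \<open>|1\<rangle>\<close> on qubit 1, undo the gates, and use that \<open>\<sigma>\<^sub>z \<otimes> \<sigma>\<^sub>z\<close> fixes the seed state:
  this replaces \<open>U\<close> by \<open>\<sigma>\<^sub>z U\<^sup>\<dagger> \<sigma>\<^sub>z\<close> and leaves the real rotation on qubit 3 unchanged.
\<close>

lemma LU_ctrl_cnj:
  fixes c s :: real
  assumes "p * cnj p + q * cnj q = 1" and "c\<^sup>2 + s\<^sup>2 = 1"
  shows "LU_equivalent (ctrl_state a b (su2 (cnj p) q) (su2 c s)) (ctrl_state a b (su2 p q) (su2 c s))"
proof -
  let ?U = "su2 p q" and ?U' = "su2 (cnj p) (- q)" and ?W = "su2 c s" and ?W' = "su2 c (- s)"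
  have cs: "of_real c * cnj (of_real c) + of_real s * cnj (of_real s) = (1 :: complex)"
    using assms(2) by (simp add: power2_eq_square flip: of_real_mult of_real_add)
  have inv: "?U' ** ?U = mat 1" "?W' ** ?W = mat 1"
    using assms(1) cs by (simp_all add: su2_mult mat2_eq_iff mat_def mult.commute add.commute)
  have "ctrl_state a b (su2 (cnj p) q) ?W =
      pair_state a b (sigma_z ** mat 1) (sigma_z ** mat 1) (sigma_z ** ?U') (sigma_z ** ?W')"
    unfolding qubit3_eq_iff forall_2 by (simp add: pair_state_def matrix_matrix_mult_def sum_2 mat_def)
  also have "LU_equivalent \<dots> (pair_state a b (mat 1) (mat 1) ?U' ?W')"
    by (intro LU_pair_state_mult unitary_sigma)
  also have "\<dots> = pair_state a b (?U' ** ?U) (?W' ** ?W) (?U' ** mat 1) (?W' ** mat 1)"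
    by (simp only: inv matrix_mul_rid)
  also have "LU_equivalent \<dots> (pair_state a b ?U ?W (mat 1) (mat 1))"
    by (intro LU_pair_state_mult unitary_su2) (use assms(1) cs in \<open>simp_all add: mult.commute\<close>)
  also have "LU_equivalent \<dots> (ctrl_state a b ?U ?W)"
    by (rule LU_pair_state_swap)
  finally show ?thesis .
qed

text \<open>Applying \<open>P\<close> to qubit 2 clears the first branch and turns the gate of the
  second into its conjugate by \<open>P\<close>.\<close>

lemma LU_pauli_conjugate:
  assumes "unitary_mat P" "P ** P = mat 1"
  shows "LU_equivalent (pair_state a b P (mat 1) (U ** P) W) (ctrl_state a b (P ** U ** P) W)"
  using LU_pair_state_mult[OF assms(1) unitary_mat_1, of a b P "mat 1" "U ** P" W] assms(2)
  by (simp add: matrix_mul_assoc LU_equivalent_sym)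

text \<open>The four pairs are the entries of P U P for P running through the identity,
  \<open>sigma_x\<close>, \<open>sigma_y\<close> and \<open>sigma_z\<close>, in this order.\<close>

lemma S_D_iff:
  assumes "U2 D = su2 p q"
  shows "(\<exists>\<phi>\<in>S_D D. LU_equivalent \<omega> \<phi>) \<longleftrightarrow>
    (\<exists>(p', q') \<in> {(p, q), (cnj p, - cnj q), (cnj p, cnj q), (p, - q)}.
      LU_equivalent \<omega> (ctrl_state (par_a D) (par_b D) (su2 p' q') (U3 D)))"
proof -
  define F where "F P = pair_state (par_a D) (par_b D) P (mat 1) (U2 D ** P) (U3 D)" for P
  have "{0..3} = {0, 1, 2, 3 :: nat}" by auto
  then have S: "S_D D = {F (mat 1), F sigma_x, F sigma_y, F sigma_z}"
    by (simp add: S_D_def pauli_def ctrl_gates_eq_pair_state F_def numeral_3_eq_3 numeral_2_eq_2)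
  have LU: "LU_equivalent \<omega> (F P) \<longleftrightarrow> LU_equivalent \<omega> (ctrl_state (par_a D) (par_b D) (su2 p' q') (U3 D))"
    if "unitary_mat P" "P ** P = mat 1" "P ** su2 p q ** P = su2 p' q'" for P p' q'
    using LU_equivalent_right_cong[OF LU_pauli_conjugate[OF that(1,2)]] by (simp add: F_def assms that(3))
  have "LU_equivalent \<omega> (F (mat 1)) \<longleftrightarrow> LU_equivalent \<omega> (ctrl_state (par_a D) (par_b D) (su2 p q) (U3 D))"
    "LU_equivalent \<omega> (F sigma_x) \<longleftrightarrow> LU_equivalent \<omega> (ctrl_state (par_a D) (par_b D) (su2 (cnj p) (- cnj q)) (U3 D))"
    "LU_equivalent \<omega> (F sigma_y) \<longleftrightarrow> LU_equivalent \<omega> (ctrl_state (par_a D) (par_b D) (su2 (cnj p) (cnj q)) (U3 D))"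
    "LU_equivalent \<omega> (F sigma_z) \<longleftrightarrow> LU_equivalent \<omega> (ctrl_state (par_a D) (par_b D) (su2 p (- q)) (U3 D))"
       apply (rule LU[OF unitary_mat_1]; simp)
      apply (rule LU[OF unitary_sigma(1)]; simp add: mat2_eq_iff matrix_matrix_mult_def sum_2 mat_def)
     apply (rule LU[OF unitary_sigma(2)]; simp add: complex_eq_iff mat2_eq_iff matrix_matrix_mult_def sum_2 mat_def)
    apply (rule LU[OF unitary_sigma(3)]; simp add: mat2_eq_iff matrix_matrix_mult_def sum_2 mat_def)
    done
  then show ?thesis unfolding S by simp
qed

lemma complex_abs_parts_eq:
  assumes "\<bar>Re z\<bar> = \<bar>Re w\<bar>" "\<bar>Im z\<bar> = \<bar>Im w\<bar>"
  shows "z = w \<or> z = - w \<or> z = cnj w \<or> z = - cnj w"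
  using assms by (auto simp: complex_eq_iff abs_eq_iff)

text \<open>This settles the sixteen sign patterns: \<open>p'\<close> is first brought to
  \<open>p\<close>, at most at the cost of the sign of \<open>q'\<close>, and the remaining patterns
  of \<open>q'\<close> are matched with the four Pauli pairs.\<close>

lemma S_D_if_abs_parts_eq:
  fixes c s :: real
  assumes "U2 D = su2 p q" "U3 D = su2 c s" "c\<^sup>2 + s\<^sup>2 = 1" "p * cnj p + q * cnj q = 1"
    and "\<bar>Re p'\<bar> = \<bar>Re p\<bar>" "\<bar>Im p'\<bar> = \<bar>Im p\<bar>" "\<bar>Re q'\<bar> = \<bar>Re q\<bar>" "\<bar>Im q'\<bar> = \<bar>Im q\<bar>"
    and "LU_equivalent \<omega> (ctrl_state (par_a D) (par_b D) (su2 p' q') (U3 D))"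
  shows "\<exists>\<phi>\<in>S_D D. LU_equivalent \<omega> \<phi>"
proof -
  define L where "L u v \<longleftrightarrow> LU_equivalent \<omega> (ctrl_state (par_a D) (par_b D) (su2 u v) (U3 D))" for u v
  have neg: "L (- u) (- v)" if "L u v" for u v
    using that LU_equivalent_right_cong[OF LU_ctrl_neg] unfolding L_def by blast
  have cnj: "L (cnj u) v" if "L u v" "u * cnj u + v * cnj v = 1" for u v
    using that(1) LU_equivalent_right_cong[OF LU_ctrl_cnj[OF that(2) assms(3)]] unfolding L_def assms(2) by blast
  have p: "p' = p \<or> p' = - p \<or> p' = cnj p \<or> p' = - cnj p" and q: "q' = q \<or> q' = - q \<or> q' = cnj q \<or> q' = - cnj q"
    using assms(5-8) complex_abs_parts_eq by blast+
  have L: "L p' q'" using assms(9) by (simp add: L_def)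
  have norm: "cnj p * p + q' * cnj q' = 1"
    using q assms(4) by (auto simp: mult.commute)
  \<comment> \<open>A minus sign moves from \<open>p'\<close> to \<open>q'\<close> by
    \<open>neg\<close>, and a conjugation of \<open>p\<close> is undone by
    \<open>cnj\<close>.\<close>
  have "L p q' \<or> L p (- q')"
    using p L neg[OF L] cnj[of "cnj p" q'] cnj[of "cnj p" "- q'"] norm by auto
  then have "L p q \<or> L p (- q) \<or> L p (cnj q) \<or> L p (- cnj q)" using q by auto
  \<comment> \<open>If the second entry is conjugated, conjugating the first as well yields the pair
    of \<open>sigma_y\<close> or \<open>sigma_x\<close>.\<close>
  then have "L p q \<or> L p (- q) \<or> L (cnj p) (cnj q) \<or> L (cnj p) (- cnj q)"
    using cnj[of p "cnj q"] cnj[of p "- cnj q"] assms(4) by (auto simp: mult.commute)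
  then show ?thesis unfolding S_D_iff[OF assms(1)] by (auto simp: L_def)
qed

section \<open>Product and maximally entangled seeds\<close>

lemma unit_phase_exists:
  assumes "cmod z = cmod w" obtains x where "cmod x = 1" "w = x * z"
proof (cases "z = 0")
  case True then show ?thesis using assms that[of 1] by simp
next
  case False
  then have "w \<noteq> 0" using assms by auto
  then show ?thesis using False assms that[of "w / z"] by (simp add: norm_divide)
qed

text \<open>With seed |00> only the first column of the gate matters, and the phases of its two
  entries can be changed independently by diagonal unitaries on qubits 1 and 2.\<close>

lemma LU_ctrl_product:
  assumes "cmod p' = cmod p" "cmod q' = cmod q"
  shows "LU_equivalent (ctrl_state a 0 (su2 p' q') W) (ctrl_state a 0 (su2 p q) W)"
proof -
  obtain x where x: "cmod x = 1" "p' = x * p" by (metis assms(1) unit_phase_exists)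
  obtain z where z: "cmod z = 1" "q' = z * q" by (metis assms(2) unit_phase_exists)
  have xx: "x * cnj x = 1" using x(1) by (simp add: complex_norm_square[symmetric])
  \<comment> \<open>\<open>V1\<close> supplies the phase of \<open>p'\<close> to the whole branch
    |1>; \<open>V2\<close> removes it again from |1> of qubit 2 and inserts that of
    \<open>cnj q'\<close>.\<close>
  define V1 V2 :: "complex^2^2" where "V1 = vector [vector [1, 0], vector [0, x]]" and "V2 = vector [vector [1, 0], vector [0, cnj x * cnj z]]"
  have "(V1 \<otimes>\<^sub>m V2 \<otimes>\<^sub>m mat 1) *v ctrl_state a 0 (su2 p q) W = ctrl_state a 0 (su2 p' q') W"
    unfolding qubit3_eq_iff forall_2 tensor_mat_mult_vec
    by (simp add: pair_state_def mat_def sum_2 V1_def V2_def x(2) z(2) mult.assoc[symmetric] xx)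
  moreover have "unitary_mat V1" "unitary_mat V2"
    unfolding V1_def V2_def using x(1) z(1) by (simp_all add: unitary_phase_gate norm_mult)
  ultimately show ?thesis using LU_equivalentI[of V1 V2 "mat 1"] by (metis unitary_mat_1)
qed

text \<open>For the maximally entangled seed, \<open>(V \<otimes> V\<^sup>*)\<close> fixes the seed, so \<open>U\<close> only matters up to conjugation.\<close>

lemma LU_ctrl_conjugate:
  assumes "u * cnj u + v * cnj v = 1" and "su2 u v ** U = U' ** su2 u v"
  shows "LU_equivalent (ctrl_state a a U' (mat 1)) (ctrl_state a a U (mat 1))"
proof -
  let ?V = "su2 u v" and ?V' = "su2 (cnj u) (cnj v)"
  have "pair_state a a (?V ** mat 1) (?V' ** mat 1) (U' ** ?V) (?V' ** mat 1) = ctrl_state a a U' (mat 1)"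
  proof -
    \<comment> \<open>\<open>?V'\<close> is the entrywise conjugate of \<open>?V\<close>, so its
      transpose is the adjoint of \<open>?V\<close> and cancels it.\<close>
    have "(\<Sum>m\<in>UNIV. (\<Sum>l\<in>UNIV. U' $ j $ l * ?V $ l $ m) * ?V' $ k $ m) = U' $ j $ k" for j k
    proof -
      have "(U' $ j $ 1 * u - U' $ j $ 2 * cnj v) * cnj u + (U' $ j $ 1 * v + U' $ j $ 2 * cnj u) * cnj v
          = U' $ j $ 1 * (u * cnj u + v * cnj v)" by (simp add: algebra_simps)
      moreover have "(U' $ j $ 1 * u - U' $ j $ 2 * cnj v) * - v + (U' $ j $ 1 * v + U' $ j $ 2 * cnj u) * u
          = U' $ j $ 2 * (u * cnj u + v * cnj v)" by (simp add: algebra_simps)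
      ultimately show ?thesis using exhaust_2[of k] assms(1) by (auto simp: sum_2)
    qed
    note row = this[unfolded sum_2]
    show ?thesis
      unfolding qubit3_eq_iff forall_2
      using assms(1) row[of 1 1] row[of 1 2] row[of 2 1] row[of 2 2]
      by (simp add: pair_state_def matrix_matrix_mult_def sum_2 mat_def mult.assoc
          flip: distrib_left right_diff_distrib) (simp add: algebra_simps)
  qed
  moreover have "LU_equivalent (pair_state a a (?V ** mat 1) (?V' ** mat 1) (?V ** U) (?V' ** mat 1)) (ctrl_state a a U (mat 1))"
    by (intro LU_pair_state_mult unitary_su2) (use assms(1) in \<open>simp_all add: mult.commute\<close>)
  ultimately show ?thesis using assms(2) by simp
qed

lemma su2_1_0: "su2 1 0 = mat 1"
  by (simp add: mat2_eq_iff mat_def)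

text \<open>Conjugation diagonalizes the gate; its eigenvalues are fixed by the trace 2
  \<open>Re p\<close>. The conjugation and sign moves reduce to nonnegative imaginary and real part
  of \<open>p\<close>.\<close>

lemma LU_ctrl_diagonal:
  assumes "p * cnj p + q * cnj q = 1"
  shows "LU_equivalent (ctrl_state a a (su2 (Complex \<bar>Re p\<bar> (sqrt (1 - (Re p)\<^sup>2))) 0) (mat 1)) (ctrl_state a a (su2 p q) (mat 1))"
proof -
  have pos: "LU_equivalent (ctrl_state a a (su2 (Complex (Re p) (sqrt (1 - (Re p)\<^sup>2))) 0) (mat 1)) (ctrl_state a a (su2 p q) (mat 1))"
    if pq: "p * cnj p + q * cnj q = 1" and "Im p \<ge> 0" for p q
  proof -
    define x y where "x = Im p" and "y = sqrt (1 - (Re p)\<^sup>2)"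
    have norm: "(Re p)\<^sup>2 + x\<^sup>2 + (cmod q)\<^sup>2 = 1"
      using pq by (simp add: complex_eq_iff power2_eq_square x_def cmod_def)
    then have "1 - (Re p)\<^sup>2 = x\<^sup>2 + (cmod q)\<^sup>2" by simp
    then have y: "y \<ge> 0" "y\<^sup>2 = x\<^sup>2 + (cmod q)\<^sup>2" by (simp_all add: y_def)
    \<comment> \<open>The norm of the vector (x + y, -iq). As x and y are nonnegative, it vanishes
      only if q = 0 and \<open>Im p\<close> = 0, when the gate is already diagonal.\<close>
    define n where "n = sqrt ((x + y)\<^sup>2 + (cmod q)\<^sup>2)"
    have n: "n\<^sup>2 = (x + y)\<^sup>2 + (cmod q)\<^sup>2" by (simp add: n_def)
    show ?thesis
    proof (cases "n = 0")
      case True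
      then have "x + y = 0" "q = 0" using n by (auto simp: sum_power2_eq_zero_iff)
      then have "Complex (Re p) y = p" using y(1) \<open>Im p \<ge> 0\<close> by (simp add: x_def complex_eq_iff)
      then show ?thesis by (simp add: y_def \<open>q = 0\<close>)
    next
      case False
      have qq: "q * cnj q = (cmod q)\<^sup>2" by (metis complex_norm_square)
      \<comment> \<open>The row (u, v) is a normalized left eigenvector of \<open>su2 p q\<close>
        for the eigenvalue \<open>Re p\<close> + iy, because y^2 - x^2 = |q|^2.\<close>
      define u v where "u = complex_of_real ((x + y) / n)" and "v = - \<i> * q / n"
      have "LU_equivalent (ctrl_state a a (su2 (Complex (Re p) y) 0) (mat 1)) (ctrl_state a a (su2 p q) (mat 1))"
      proof (rule LU_ctrl_conjugate)
        have "q * cnj q = - (\<i> * q * (\<i> * cnj q))" by (simp add: complex_eq_iff)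
        then have "v * cnj v = q * cnj q / (of_real n * of_real n)" by (simp only:) (simp add: v_def)
        then have "v * cnj v = of_real ((cmod q)\<^sup>2 / n\<^sup>2)"
          unfolding qq by (simp add: power2_eq_square)
        moreover have "u * cnj u = of_real ((x + y)\<^sup>2 / n\<^sup>2)"
          unfolding u_def complex_cnj_complex_of_real of_real_mult[symmetric] power2_eq_square by simp
        ultimately have "u * cnj u + v * cnj v = of_real (((x + y)\<^sup>2 + (cmod q)\<^sup>2) / n\<^sup>2)"
          by (simp only: of_real_add add_divide_distrib)
        then show "u * cnj u + v * cnj v = 1" using False by (simp flip: n)
        have p: "p = of_real (Re p) + \<i> * of_real x" "cnj p = of_real (Re p) - \<i> * of_real x"
          "Complex (Re p) y = of_real (Re p) + \<i> * of_real y"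
          by (simp_all add: complex_eq_iff x_def)
        have yy: "of_real y * of_real y = of_real x * of_real x + q * cnj q"
          using y(2) by (simp add: qq power2_eq_square flip: of_real_mult of_real_add)
        have "u * p - v * cnj q = Complex (Re p) y * u"
        proof -
          have "of_real (x + y) * (of_real (Re p) + \<i> * of_real x) + \<i> * (q * cnj q) = (of_real (Re p) + \<i> * of_real y) * of_real (x + y)"
            unfolding of_real_add using yy by algebra
          then show ?thesis using False unfolding p(3)
            by (subst p(1)) (simp add: u_def v_def divide_simps mult.assoc)
        qed
        moreover have "u * q + v * cnj p = Complex (Re p) y * v"
          using False unfolding p(2,3) by (simp add: u_def v_def divide_simps) (simp add: algebra_simps)
        ultimately show "su2 u v ** su2 p q = su2 (Complex (Re p) y) 0 ** su2 u v"
          by (simp add: su2_mult)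
      qed
      then show ?thesis by (simp add: y_def)
    qed
  qed
  \<comment> \<open>Makes \<open>LU_ctrl_cnj\<close> available with the identity on qubit 3.\<close>
  have 1: "(1::real)\<^sup>2 + 0\<^sup>2 = 1" by simp
  have pos_Re: "LU_equivalent (ctrl_state a a (su2 (Complex (Re p) (sqrt (1 - (Re p)\<^sup>2))) 0) (mat 1)) (ctrl_state a a (su2 p q) (mat 1))"
    if pq: "p * cnj p + q * cnj q = 1" for p q
  proof (cases "Im p \<ge> 0")
    case False
    then show ?thesis using pos[of "cnj p" q] LU_ctrl_cnj[OF pq 1, of a a] pq
      by (auto simp: su2_1_0 mult.commute intro: LU_equivalent_trans)
  qed (use pos pq in blast)
  show ?thesis
  proof (cases "Re p \<ge> 0")
    case True then show ?thesis using pos_Re[OF assms] by simp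
  next
    case False
    then show ?thesis using pos_Re[of "- p" "- q"] LU_ctrl_neg[of a a p q "mat 1"] assms
      by (auto intro: LU_equivalent_trans)
  qed
qed

text \<open>Both states reduce to the same diagonal normal form.\<close>

lemma LU_ctrl_max_entangled:
  assumes "p * cnj p + q * cnj q = 1" "p' * cnj p' + q' * cnj q' = 1" "\<bar>Re p\<bar> = \<bar>Re p'\<bar>"
  shows "LU_equivalent (ctrl_state a a (su2 p' q') (mat 1)) (ctrl_state a a (su2 p q) (mat 1))"
proof -
  have "(Re p)\<^sup>2 = (Re p')\<^sup>2" using assms(3) by (metis power2_abs)
  then have "LU_equivalent (ctrl_state a a (su2 (Complex \<bar>Re p\<bar> (sqrt (1 - (Re p)\<^sup>2))) 0) (mat 1))
      (ctrl_state a a (su2 p' q') (mat 1))"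
    using LU_ctrl_diagonal[OF assms(2), of a] assms(3) by simp
  from LU_equivalent_trans[OF LU_equivalent_sym[OF this] LU_ctrl_diagonal[OF assms(1)]]
  show ?thesis .
qed

subsection \<open>Parameters recovered from the gates and the measures\<close>

lemma reduce_mod_pi:
  obtains k :: int and y :: real where "x = y + k * pi" "y \<in> {- pi / 2 <.. pi / 2}"
proof
  \<comment> \<open>The ceiling, not the floor, makes pi/2 the included endpoint.\<close>
  define k where "k = \<lceil>x / pi - 1 / 2\<rceil>"
  show "x = (x - k * pi) + k * pi" by simp
  have "x / pi - 1 / 2 \<le> k" "k < x / pi - 1 / 2 + 1" unfolding k_def by linarith+
  then show "x - k * pi \<in> {- pi / 2 <.. pi / 2}"
    by (simp add: field_simps)
qed

lemma cis_int_pi: "cis (x + of_int k * pi) = (if even k then 1 else - 1) * cis x"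
  by (auto simp: complex_eq_iff cos_add sin_add mult.commute[of _ pi])

text \<open>Half the sum and half the difference of the arguments of \<open>p\<close> and
  \<open>q\<close> give the outer angles. Reducing them modulo pi costs a sign common to
  \<open>p\<close> and \<open>q\<close>, which \<open>LU_ctrl_neg\<close> absorbs later.\<close>

lemma Euler_angles:
  assumes "p * cnj p + q * cnj q = 1"
  obtains \<alpha> \<beta> \<gamma> where "\<alpha> \<in> {- pi / 2 <.. pi / 2}" "\<gamma> \<in> {- pi / 2 <.. pi / 2}" "\<beta> \<in> {0 .. pi / 2}"
    "\<And>D. par_alpha D = \<alpha> \<Longrightarrow> par_beta D = \<beta> \<Longrightarrow> par_gamma D = \<gamma> \<Longrightarrow> U2 D \<in> {su2 p q, su2 (- p) (- q)}"
proof -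
  have norm: "(cmod p)\<^sup>2 + (cmod q)\<^sup>2 = 1"
    using assms by (simp add: complex_eq_iff power2_eq_square cmod_def)
  define \<beta> where "\<beta> = arccos (cmod p)"
  have "cmod p \<le> 1" using norm by (metis abs_norm_cancel abs_square_le_1 le_add_same_cancel1 zero_le_power2)
  then have \<beta>: "\<beta> \<in> {0 .. pi / 2}" "cos \<beta> = cmod p"
    using arccos_le_pi2[of "cmod p"] arccos_lbound[of "cmod p"] by (auto simp: \<beta>_def cos_arccos order_trans[OF _ norm_ge_zero])
  have "sin \<beta> = cmod q"
  proof -
    have "(sin \<beta>)\<^sup>2 = (cmod q)\<^sup>2" using norm \<beta>(2) sin_cos_squared_add[of \<beta>] by simp
    moreover have "sin \<beta> \<ge> 0" using \<beta>(1) by (auto intro: sin_ge_zero)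
    ultimately show ?thesis by (simp add: power2_eq_iff_nonneg)
  qed
  \<comment> \<open>If \<open>p\<close> or \<open>q\<close> vanishes, \<open>Arg\<close> has the
    value 0; this is harmless, as the modulus is then 0.\<close>
  obtain \<alpha> k where \<alpha>: "(Arg p + Arg q) / 2 = \<alpha> + of_int k * pi" "\<alpha> \<in> {- pi / 2 <.. pi / 2}" by (rule reduce_mod_pi)
  obtain \<gamma> l where \<gamma>: "(Arg p - Arg q) / 2 = \<gamma> + of_int l * pi" "\<gamma> \<in> {- pi / 2 <.. pi / 2}" by (rule reduce_mod_pi)
  \<comment> \<open>One sign serves both entries, since k + l and k - l have the same
    parity.\<close>
  define e :: complex where "e = (if even (k + l) then 1 else - 1)"
  have "Arg p = (\<alpha> + \<gamma>) + of_int (k + l) * pi" "Arg q = (\<alpha> - \<gamma>) + of_int (k - l) * pi"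
    using \<alpha>(1) \<gamma>(1) by (simp_all add: algebra_simps)
  then have "cis (Arg p) = e * cis (\<alpha> + \<gamma>)" "cis (Arg q) = e * cis (\<alpha> - \<gamma>)"
    by (simp_all only: cis_int_pi e_def even_add even_diff)
  then have "p = e * (cis (\<alpha> + \<gamma>) * cos \<beta>)" "q = e * (cis (\<alpha> - \<gamma>) * sin \<beta>)"
    using rcis_cmod_Arg[of p] rcis_cmod_Arg[of q] \<open>sin \<beta> = cmod q\<close> \<beta>(2) by (simp_all add: rcis_def mult_ac)
  then have "U2 D \<in> {su2 p q, su2 (- p) (- q)}" if "par_alpha D = \<alpha>" "par_beta D = \<beta>" "par_gamma D = \<gamma>" for D
    using that by (auto simp: U2_su2 e_def)
  with that \<alpha>(2) \<gamma>(2) \<beta>(1) show ?thesis by blast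
qed

lemma su2_unit_parts:
  assumes "p * cnj p + q * cnj q = 1"
  shows "(Re p)\<^sup>2 + (Im p)\<^sup>2 + (Re q)\<^sup>2 + (Im q)\<^sup>2 = 1"
  using assms by (simp add: complex_eq_iff power2_eq_square)

lemma U2_unit:
  obtains p q where "U2 D = su2 p q" "p * cnj p + q * cnj q = 1"
proof
  show "U2 D = su2 (cis (par_alpha D + par_gamma D) * cos (par_beta D)) (cis (par_alpha D - par_gamma D) * sin (par_beta D))"
    by (rule U2_su2)
  have "(cis x * of_real y) * cnj (cis x * of_real y) = of_real (y\<^sup>2)" for x y
  proof -
    have "cis x * cnj (cis x) = 1" by (simp add: cis_cnj cis_mult)
    moreover have "(cis x * of_real y) * cnj (cis x * of_real y) = cis x * cnj (cis x) * of_real (y\<^sup>2)"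
      by (simp only: complex_cnj_mult complex_cnj_complex_of_real power2_eq_square of_real_mult mult_ac)
    ultimately show ?thesis by (simp only: mult_1)
  qed
  then show "(cis (par_alpha D + par_gamma D) * cos (par_beta D)) * cnj (cis (par_alpha D + par_gamma D) * cos (par_beta D)) +
      (cis (par_alpha D - par_gamma D) * sin (par_beta D)) * cnj (cis (par_alpha D - par_gamma D) * sin (par_beta D)) = 1"
    by (simp only: of_real_add[symmetric]) simp
qed

lemma E1_eq_imp:
  assumes "admissible D" "admissible D'" "E1 D' = E1 D"
  shows "par_a D' = par_a D" "par_b D' = par_b D"
proof -
  have *: "(par_a D)\<^sup>2 + (par_b D)\<^sup>2 = 1" "0 \<le> par_b D" "par_b D \<le> par_a D" if "admissible D" for D
    using that by (auto simp: admissible_def)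
  have "(par_a D')\<^sup>2 - (par_b D')\<^sup>2 = (par_a D)\<^sup>2 - (par_b D)\<^sup>2"
  proof (rule bin_ent_eq_iff[THEN iffD1])
    show "bin_ent ((par_a D')\<^sup>2 - (par_b D')\<^sup>2) = bin_ent ((par_a D)\<^sup>2 - (par_b D)\<^sup>2)"
      using assms(3) E1_value *(1) assms(1,2) by metis
  qed (use *[OF assms(1)] *[OF assms(2)] in \<open>simp_all add: power_mono\<close>, (smt (verit) zero_le_power2)+)
  then have "(par_a D')\<^sup>2 = (par_a D)\<^sup>2" "(par_b D')\<^sup>2 = (par_b D)\<^sup>2"
    using *(1)[OF assms(1)] *(1)[OF assms(2)] by linarith+
  then show "par_a D' = par_a D" "par_b D' = par_b D"
    using *[OF assms(1)] *[OF assms(2)] by (auto intro!: power2_eq_imp_eq)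
qed

text \<open>On the admissible range the cosine is nonnegative and injective, so
  \<open>bin_ent\<close> determines the angle.\<close>

lemma E3_eq_imp:
  assumes "admissible D" "admissible D'" "E3 D' = E3 D"
  shows "par_beta' D' = par_beta' D"
proof -
  have v: "E3 D = bin_ent (cos (par_beta' D))" and r: "0 \<le> par_beta' D" "par_beta' D \<le> pi / 2"
    and c: "0 \<le> cos (par_beta' D)" if "admissible D" for D
  proof -
    show r: "0 \<le> par_beta' D" "par_beta' D \<le> pi / 2" using that by (auto simp: admissible_def)
    then show c: "0 \<le> cos (par_beta' D)" by (intro cos_ge_zero) auto
    have "complex_of_real (cos (par_beta' D)) * cnj (cos (par_beta' D)) + complex_of_real (sin (par_beta' D)) * cnj (sin (par_beta' D)) = 1"
      by (simp only: complex_cnj_complex_of_real sin_cos_squared_add3 of_real_1 flip: of_real_mult of_real_add)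
    from gate_entropy_su2[OF this] show "E3 D = bin_ent (cos (par_beta' D))"
      using c by (simp add: E3_def U3_su2)
  qed
  have "cos (par_beta' D') = cos (par_beta' D)"
    using assms v c by (metis bin_ent_eq_iff cos_le_one)
  then show ?thesis using r[OF assms(1)] r[OF assms(2)] by (metis cos_inj_pi pi_half_le_two order_trans pi_ge_zero field_sum_of_halves le_add_same_cancel1 divide_nonneg_nonneg zero_le_numeral)
qed

text \<open>\<open>E2\<close> yields \<open>Re p\<close>, \<open>E4\<close> then \<open>Im p\<close>
  because its coefficient a^2 - b^2 is nonzero, \<open>E5\<close> then \<open>Im q\<close> because 4
  a^2 b^2 is nonzero, and normalization leaves \<open>Re q\<close>, all up to sign.\<close>

lemma E245_eq_imp:
  assumes "admissible D" "E2 D' = E2 D" "E4 D' = E4 D" "E5 D' = E5 D"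
    and ab: "par_a D' = par_a D" "par_b D' = par_b D"
    and "U2 D = su2 p q" "p * cnj p + q * cnj q = 1" "U2 D' = su2 p' q'" "p' * cnj p' + q' * cnj q' = 1"
  shows "\<bar>Re p'\<bar> = \<bar>Re p\<bar>"
    and "par_a D \<noteq> par_b D \<Longrightarrow> \<bar>Im p'\<bar> = \<bar>Im p\<bar>"
    and "par_a D \<noteq> par_b D \<Longrightarrow> par_b D \<noteq> 0 \<Longrightarrow> \<bar>Re q'\<bar> = \<bar>Re q\<bar> \<and> \<bar>Im q'\<bar> = \<bar>Im q\<bar>"
proof -
  let ?a = "par_a D" and ?b = "par_b D"
  have D: "?a\<^sup>2 + ?b\<^sup>2 = 1" "0 \<le> ?b" "?b \<le> ?a" using assms(1) by (auto simp: admissible_def)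
  note parts = su2_unit_parts[OF assms(8)] su2_unit_parts[OF assms(10)]
  have nn: "0 \<le> (Re p)\<^sup>2" "0 \<le> (Im p)\<^sup>2" "0 \<le> (Re q)\<^sup>2" "0 \<le> (Im q)\<^sup>2"
    "0 \<le> (Re p')\<^sup>2" "0 \<le> (Im p')\<^sup>2" "0 \<le> (Re q')\<^sup>2" "0 \<le> (Im q')\<^sup>2" by simp_all
  have le: "(Re p)\<^sup>2 + (Im p)\<^sup>2 \<le> 1" "(Re p')\<^sup>2 + (Im p')\<^sup>2 \<le> 1"
    "(Re p)\<^sup>2 + (Im q)\<^sup>2 \<le> 1" "(Re p')\<^sup>2 + (Im q')\<^sup>2 \<le> 1"
    using parts nn by linarith+
  have "(Re p)\<^sup>2 \<le> 1" "(Re p')\<^sup>2 \<le> 1" using parts nn by linarith+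
  then have "\<bar>Re p\<bar> \<le> 1" "\<bar>Re p'\<bar> \<le> 1" by (simp_all add: abs_square_le_1)
  then show Re: "\<bar>Re p'\<bar> = \<bar>Re p\<bar>"
    using assms(2) unfolding E2_def assms(7,9) gate_entropy_su2[OF assms(8)] gate_entropy_su2[OF assms(10)]
    by (subst (asm) bin_ent_eq_iff) auto
  then have Re2: "(Re p')\<^sup>2 = (Re p)\<^sup>2" by (metis power2_abs)
  have ab2: "4 * ?a\<^sup>2 * ?b\<^sup>2 = 1 - (?a\<^sup>2 - ?b\<^sup>2)\<^sup>2" using D(1) by algebra
  \<comment> \<open>These bounds keep the arguments of \<open>bin_ent\<close> in [0, 1], where it is
    injective.\<close>
  then have K: "(?a\<^sup>2 - ?b\<^sup>2)\<^sup>2 \<le> 1" "4 * ?a\<^sup>2 * ?b\<^sup>2 \<le> 1" "0 \<le> 4 * ?a\<^sup>2 * ?b\<^sup>2" by (smt (verit) zero_le_power2 mult_nonneg_nonneg)+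
  show Im: "\<bar>Im p'\<bar> = \<bar>Im p\<bar>" if "?a \<noteq> ?b"
  proof -
    define f where "f x y = sqrt (x + (?a\<^sup>2 - ?b\<^sup>2)\<^sup>2 * y)" for x y
    have f: "0 \<le> f x y" "f x y \<le> 1" if "0 \<le> x" "0 \<le> y" "x + y \<le> 1" for x y
      using that mult_right_mono[OF K(1) that(2)] by (auto simp: f_def)
    have "bin_ent (f ((Re p')\<^sup>2) ((Im p')\<^sup>2)) = bin_ent (f ((Re p)\<^sup>2) ((Im p)\<^sup>2))"
      using assms(3) E4_value[OF D(1) assms(7,8)] E4_value[of D', unfolded ab, OF D(1) assms(9,10)] by (simp add: f_def)
    then have "f ((Re p')\<^sup>2) ((Im p')\<^sup>2) = f ((Re p)\<^sup>2) ((Im p)\<^sup>2)"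
      by (subst (asm) bin_ent_eq_iff) (auto intro!: f le)
    moreover have "?a\<^sup>2 - ?b\<^sup>2 \<noteq> 0" using that D by (simp add: power2_eq_iff_nonneg)
    ultimately have "(Im p')\<^sup>2 = (Im p)\<^sup>2" unfolding f_def Re2 by simp
    then show ?thesis by (metis real_sqrt_abs)
  qed
  show "\<bar>Re q'\<bar> = \<bar>Re q\<bar> \<and> \<bar>Im q'\<bar> = \<bar>Im q\<bar>" if "?a \<noteq> ?b" "?b \<noteq> 0"
  proof -
    define f where "f x y = sqrt (1 - 4 * ?a\<^sup>2 * ?b\<^sup>2 * (1 - x - y))" for x y
    have f: "0 \<le> f x y" "f x y \<le> 1" if "0 \<le> x" "0 \<le> y" "x + y \<le> 1" for x y
      using that mult_left_mono[of "1 - x - y" 1, OF _ K(3)] mult_nonneg_nonneg[OF K(3), of "1 - x - y"] K(2) by (auto simp: f_def)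
    have "bin_ent (f ((Re p')\<^sup>2) ((Im q')\<^sup>2)) = bin_ent (f ((Re p)\<^sup>2) ((Im q)\<^sup>2))"
      using assms(4) E5_value[OF D(1) assms(7,8)] E5_value[of D', unfolded ab, OF D(1) assms(9,10)] by (simp add: f_def)
    then have "f ((Re p')\<^sup>2) ((Im q')\<^sup>2) = f ((Re p)\<^sup>2) ((Im q)\<^sup>2)"
      by (subst (asm) bin_ent_eq_iff) (auto intro!: f le)
    moreover have "4 * ?a\<^sup>2 * ?b\<^sup>2 \<noteq> 0" using that D by auto
    ultimately have "(Im q')\<^sup>2 = (Im q)\<^sup>2" unfolding f_def Re2 by simp
    moreover from this have "(Re q')\<^sup>2 = (Re q)\<^sup>2"
      using parts Re2 Im[OF that(1)] power2_abs[of "Im p"] power2_abs[of "Im p'"] by simp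
    ultimately show ?thesis by (metis real_sqrt_abs)
  qed
qed

section \<open>Both directions of the characterization\<close>

theorem mainTheorem2:
  fixes D :: params and chi :: "complex ^ (2 \<times> 2 \<times> 2)"
  assumes "admissible D"
    and "truly_tripartite_entangled (psi_D D)"
    and "norm chi = 1"
  shows "(\<exists>D'. admissible D' \<and>
            E1 D' = E1 D \<and> E2 D' = E2 D \<and> E3 D' = E3 D \<and> E4 D' = E4 D \<and> E5 D' = E5 D \<and>
            LU_equivalent chi (psi_D D'))
         \<longleftrightarrow> (\<exists>\<phi>\<in>S_D D. LU_equivalent chi \<phi>)"
proof -
  let ?a = "par_a D" and ?b = "par_b D" and ?c = "cos (par_beta' D)" and ?s = "sin (par_beta' D)"
  have adm: "?a\<^sup>2 + ?b\<^sup>2 = 1" "0 \<le> ?b" "?b \<le> ?a" using assms(1) by (auto simp: admissible_def)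
  obtain p q where U: "U2 D = su2 p q" and pq: "p * cnj p + q * cnj q = 1" by (rule U2_unit)
  define L where "L u v \<longleftrightarrow> LU_equivalent chi (ctrl_state ?a ?b (su2 u v) (U3 D))" for u v
  \<comment> \<open>The convention \<open>par_beta' D = 0\<close> trivializes the gate on qubit 3,
    as the conjugation argument requires.\<close>
  have U3_eq: "U3 D = mat 1" if "?a = ?b"
    using that assms(1) su2_1_0 by (auto simp: admissible_def U3_su2)
  note S = S_D_iff[OF U, of chi, folded L_def]
  show ?thesis
  proof
    assume "\<exists>D'. admissible D' \<and>
            E1 D' = E1 D \<and> E2 D' = E2 D \<and> E3 D' = E3 D \<and> E4 D' = E4 D \<and> E5 D' = E5 D \<and>
            LU_equivalent chi (psi_D D')"
    then obtain D' where D': "admissible D'" and E: "E1 D' = E1 D" "E2 D' = E2 D" "E3 D' = E3 D" "E4 D' = E4 D" "E5 D' = E5 D"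
      and chi: "LU_equivalent chi (psi_D D')" by blast
    note ab = E1_eq_imp[OF assms(1) D' E(1)]
    have U3: "U3 D' = U3 D" using E3_eq_imp[OF assms(1) D' E(3)] by (simp add: U3_def)
    obtain p' q' where U': "U2 D' = su2 p' q'" and pq': "p' * cnj p' + q' * cnj q' = 1" by (rule U2_unit)
    note parts = E245_eq_imp[OF assms(1) E(2,4,5) ab U pq U' pq']
    have L: "L p' q'" using chi by (simp add: psi_D_eq ab U' U3 L_def)
    \<comment> \<open>Maximally entangled, product and generic seed; only the last needs all sixteen
      sign patterns.\<close>
    consider "?a = ?b" | "?a \<noteq> ?b" "?b = 0" | "?a \<noteq> ?b" "?b \<noteq> 0" by blast
    then show "\<exists>\<phi>\<in>S_D D. LU_equivalent chi \<phi>"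
    proof cases
      case 1
      have "L p q" using L LU_equivalent_right_cong[OF LU_ctrl_max_entangled[OF pq pq' parts(1)[symmetric]]]
        by (simp add: L_def 1 U3_eq)
      then show ?thesis using S by auto
    next
      case 2
      have "cmod p' = cmod p" using parts(1,2) 2 by (metis cmod_def power2_abs)
      moreover from this have "cmod q' = cmod q"
      proof -
        have "(cmod p)\<^sup>2 + (cmod q)\<^sup>2 = 1" "(cmod p')\<^sup>2 + (cmod q')\<^sup>2 = 1"
          using su2_unit_parts[OF pq] su2_unit_parts[OF pq'] by (simp_all add: cmod_power2)
        then have "(cmod q')\<^sup>2 = (cmod q)\<^sup>2" unfolding \<open>cmod p' = cmod p\<close> by linarith
        then show ?thesis by (metis norm_ge_zero power2_eq_imp_eq)
      qed
      ultimately have "L p q" using L unfolding L_def 2(2)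
        by (blast intro: LU_equivalent_right_cong[OF LU_ctrl_product, THEN iffD1])
      then show ?thesis using S by auto
    next
      case 3
      then show ?thesis
        using S_D_if_abs_parts_eq[OF U U3_su2 _ pq parts(1,2) _ _ L[unfolded L_def]] parts(3) by auto
    qed
  next
    assume "\<exists>\<phi>\<in>S_D D. LU_equivalent chi \<phi>"
    then obtain p' q' where p'q': "(p', q') \<in> {(p, q), (cnj p, - cnj q), (cnj p, cnj q), (p, - q)}" and L: "L p' q'"
      using S by auto
    have pq': "p' * cnj p' + q' * cnj q' = 1" using p'q' pq by (auto simp: mult.commute)
    have sq: "(Re p')\<^sup>2 = (Re p)\<^sup>2" "(Im p')\<^sup>2 = (Im p)\<^sup>2" "(Im q')\<^sup>2 = (Im q)\<^sup>2" "\<bar>Re p\<bar> = \<bar>Re p'\<bar>"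
      using p'q' by auto
    show "\<exists>D'. admissible D' \<and>
            E1 D' = E1 D \<and> E2 D' = E2 D \<and> E3 D' = E3 D \<and> E4 D' = E4 D \<and> E5 D' = E5 D \<and>
            LU_equivalent chi (psi_D D')"
    proof (cases "?a = ?b")
      \<comment> \<open>The convention \<open>par_gamma D = 0\<close> excludes general Euler angles
        here. All four gates share |\<open>Re p\<close>|, so \<open>D\<close> itself is the
        witness.\<close>
      case True
      have "L p q" using L LU_equivalent_right_cong[OF LU_ctrl_max_entangled[OF pq pq' sq(4)]]
        by (simp add: L_def True U3_eq)
      then have "LU_equivalent chi (psi_D D)" by (simp add: psi_D_eq U L_def)
      then show ?thesis using assms(1) by blast
    next
      case False
      obtain \<alpha> \<beta> \<gamma> where r: "\<alpha> \<in> {- pi / 2 <.. pi / 2}" "\<gamma> \<in> {- pi / 2 <.. pi / 2}" "\<beta> \<in> {0 .. pi / 2}"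
        and eu: "\<And>D. par_alpha D = \<alpha> \<Longrightarrow> par_beta D = \<beta> \<Longrightarrow> par_gamma D = \<gamma> \<Longrightarrow> U2 D \<in> {su2 p' q', su2 (- p') (- q')}"
        using Euler_angles[OF pq'] by metis
      \<comment> \<open>Only the gate on qubit 2 changes, so \<open>E1\<close> and \<open>E3\<close>
        are kept.\<close>
      define D' where "D' = D\<lparr>par_alpha := \<alpha>, par_beta := \<beta>, par_gamma := \<gamma>\<rparr>"
      have same: "par_a D' = ?a" "par_b D' = ?b" "U3 D' = U3 D" by (simp_all add: D'_def U3_def)
      have "U2 D' \<in> {su2 p' q', su2 (- p') (- q')}" by (rule eu) (simp_all add: D'_def)
      then obtain p'' q'' where U': "U2 D' = su2 p'' q''" and s: "p'' = p' \<and> q'' = q' \<or> p'' = - p' \<and> q'' = - q'" by auto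
      have pq'': "p'' * cnj p'' + q'' * cnj q'' = 1" using s pq' by auto
      have sq': "(Re p'')\<^sup>2 = (Re p)\<^sup>2" "(Im p'')\<^sup>2 = (Im p)\<^sup>2" "(Im q'')\<^sup>2 = (Im q)\<^sup>2" "\<bar>Re p''\<bar> = \<bar>Re p\<bar>"
        using sq s by auto
      have "admissible D'" using assms(1) r False by (simp add: admissible_def D'_def)
      moreover have "E1 D' = E1 D" by (simp add: E1_def psi_s_def same)
      moreover have "E2 D' = E2 D" by (simp add: E2_def U U' gate_entropy_su2 pq pq'' sq')
      moreover have "E3 D' = E3 D" by (simp add: E3_def same)
      moreover have "E4 D' = E4 D"
        using E4_value[OF adm(1) U pq] E4_value[of D', unfolded same, OF adm(1) U' pq''] by (simp add: sq')
      moreover have "E5 D' = E5 D"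
        using E5_value[OF adm(1) U pq] E5_value[of D', unfolded same, OF adm(1) U' pq''] by (simp add: sq')
      moreover have "LU_equivalent chi (psi_D D')"
        using L s LU_equivalent_right_cong[OF LU_ctrl_neg] by (auto simp: psi_D_eq same U' L_def)
      ultimately show ?thesis by blast
    qed
  qed
qed

end
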